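(* Let $K$ be a finite extension of $\mathbb{Q}$ with ring of integers $\mathcal{O}_K$, and let $\mathfrak{B}$ be a primitive collection of non-zero ideals in $\mathcal{O}_K$. Then $\eta^*$ is an $\mathcal{O}_K$-Toeplitz array and $X_{\eta^*}$ is the unique minimal subset of $X_\eta$ (in particular $X_{\eta^*}\subseteq X_\eta$). Moreover, $\eta^*\leq\eta$ (coordinatewise).
   Context: A collection $\mathfrak{A}$ of non-zero ideals of $\mathcal{O}_K$ is primitive if $\mathfrak{b},\mathfrak{b}'\in\mathfrak{A}$ and $\mathfrak{b}\subseteq\mathfrak{b}'$ imply $\mathfrak{b}=\mathfrak{b}'$. Put $\mathcal{M}_{\mathfrak{A}}=\bigcup_{\mathfrak{b}\in\mathfrak{A}}\mathfrak{b}$ and $\mathcal{F}_{\mathfrak{A}}=\mathcal{O}_K\setminus\mathcal{M}_{\mathfrak{A}}$. Put $\mathfrak{A}^{prim}=\{\mathfrak{b}\in\mathfrak{A}:\text{there is no }\mathfrak{b}'\in\mathfrak{A}\text{ with }\mathfrak{b}\subsetneq\mathfrak{b}'\}$. A collection $\mathcal{C}$ of ideals is pairwise coprime if $\mathfrak{c}+\mathfrak{c}'=\mathcal{O}_K$ for all distinct $\mathfrak{c},\mathfrak{c}'\in\mathcal{C}$. Write $\mathfrak{d}\mathcal{C}=\{\mathfrak{d}\mathfrak{c}:\mathfrak{c}\in\mathcal{C}\}$. Let $\mathfrak{D}$ be the set of all non-zero ideals $\mathfrak{d}\subseteq\mathcal{O}_K$ (possibly $\mathfrak{d}=\mathcal{O}_K$)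 such that $\mathfrak{d}\mathcal{C}\subseteq\mathfrak{B}$ for some infinite pairwise coprime collection $\mathcal{C}$ of ideals in $\mathcal{O}_K$. Put $\mathfrak{B}^*=(\mathfrak{B}\cup\mathfrak{D})^{prim}$. $\eta\in\{0,1\}^{\mathcal{O}_K}$ is the characteristic function of $\mathcal{F}_{\mathfrak{B}}$ and $\eta^*$ is the characteristic function of $\mathcal{F}_{\mathfrak{B}^*}$. On $\{0,1\}^{\mathcal{O}_K}$ (product topology) the group $(\mathcal{O}_K,+)$ acts by $(S_gx)_{h}=x_{h+g}$. For $x\in\{0,1\}^{\mathcal{O}_K}$, $X_x$ is the closure of $\{S_gx:g\in\mathcal{O}_K\}$. A minimal subset of $X_\eta$ is a non-empty closed shift-invariant subset in which every orbit is dense. $x\in\{0,1\}^{\mathcal{O}_K}$ is an $\mathcal{O}_K$-Toeplitz array if for every $g\in\mathcal{O}_K$ there is a finite-index subgroup $\Gamma$ of $(\mathcal{O}_K,+)$ such that $x$ is constant on $g+\Gamma$. *)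

theory Defs
  imports "HOL-Analysis.Analysis" "HOL-Algebra.Ideal_Product"
    "HOL-Computational_Algebra.Polynomial"
begin

definition number_field :: "'k::field_char_0 itself \<Rightarrow> bool" where
  "number_field _ \<longleftrightarrow>
     (\<exists>B::'k set. finite_dimensional_vector_space (\<lambda>(q::rat) (x::'k). of_rat q * x) B)"

definition OK :: "'k::field_char_0 ring" where
  "OK = \<lparr>carrier = {x. algebraic_int x}, mult = (*), one = 1, zero = 0, add = (+)\<rparr>"

definition nonzero_ideal :: "'k::field_char_0 set \<Rightarrow> bool" where
  "nonzero_ideal I \<longleftrightarrow> ideal I OK \<and> I \<noteq> {0}"

definition primitive_collection :: "'k::field_char_0 set set \<Rightarrow> bool" where
  "primitive_collection A \<longleftrightarrow>
     (\<forall>b\<in>A. nonzero_ideal b) \<and> (\<forall>b\<in>A. \<forall>b'\<in>A. b \<subseteq> b' \<longrightarrow> b = b')"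

definition prim :: "'k::field_char_0 set set \<Rightarrow> 'k set set" where
  "prim A = {b \<in> A. \<not> (\<exists>b'\<in>A. b \<subset> b')}"

definition pairwise_coprime :: "'k::field_char_0 set set \<Rightarrow> bool" where
  "pairwise_coprime C \<longleftrightarrow> pairwise (\<lambda>c c'. c <+>\<^bsub>OK\<^esub> c' = carrier OK) C"

definition multiples :: "'k::field_char_0 set set \<Rightarrow> 'k set" where
  "multiples A = \<Union>A"

definition free_set :: "'k::field_char_0 set set \<Rightarrow> 'k set" where
  "free_set A = carrier OK - multiples A"

definition D_ideals :: "'k::field_char_0 set set \<Rightarrow> 'k set set" where
  "D_ideals B = {d. nonzero_ideal d \<and>
     (\<exists>C. infinite C \<and> (\<forall>c\<in>C. ideal c OK) \<and> pairwise_coprime C \<and>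
          ideal_prod OK d ` C \<subseteq> B)}"

definition star :: "'k::field_char_0 set set \<Rightarrow> 'k set set" where
  "star B = prim (B \<union> D_ideals B)"

text \<open>Elements of $\{0,1\}^{O_K}$ are extensional functions on the carrier of \<^term>\<open>OK\<close>,
  that is, they take the value \<^term>\<open>undefined\<close> outside it; hence the restrictions below.\<close>

definition config_space :: "('k::field_char_0 \<Rightarrow> nat) topology" where
  "config_space = product_topology (\<lambda>_. discrete_topology {0, 1}) (carrier OK)"

definition eta :: "'k::field_char_0 set set \<Rightarrow> 'k \<Rightarrow> nat" where
  "eta A = restrict (indicator (free_set A)) (carrier OK)"

definition shift :: "'k::field_char_0 \<Rightarrow> ('k \<Rightarrow> nat) \<Rightarrow> 'k \<Rightarrow> nat" where
  "shift g x = (\<lambda>h\<in>carrier OK. x (h + g))"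

definition orbit_closure :: "('k::field_char_0 \<Rightarrow> nat) \<Rightarrow> ('k \<Rightarrow> nat) set" where
  "orbit_closure x = config_space closure_of {shift g x | g. g \<in> carrier OK}"

definition minimal_subset :: "('k::field_char_0 \<Rightarrow> nat) set \<Rightarrow> ('k \<Rightarrow> nat) set \<Rightarrow> bool" where
  "minimal_subset M X \<longleftrightarrow>
     M \<subseteq> X \<and> M \<noteq> {} \<and> closedin config_space M \<and>
     (\<forall>g\<in>carrier OK. shift g ` M \<subseteq> M) \<and>
     (\<forall>x\<in>M. M \<subseteq> orbit_closure x)"

definition toeplitz_array :: "('k::field_char_0 \<Rightarrow> nat) \<Rightarrow> bool" where
  "toeplitz_array x \<longleftrightarrow> x \<in> topspace config_space \<and>
     (\<forall>g\<in>carrier OK. \<exists>\<Gamma>. additive_subgroup \<Gamma> OK \<and> finite (a_rcosets\<^bsub>OK\<^esub> \<Gamma>) \<and>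
        x constant_on ((\<lambda>h. g + h) ` \<Gamma>))"

end

theory Submission
  imports Defs "Jordan_Normal_Form.Char_Poly" "HOL-Number_Theory.Cong"
begin

text \<open>
  Write $R$ for the ring of integers and $D(A)$ for the set of nonzero ideals $d$ such that
  $dC \subseteq A$ for some infinite pairwise coprime $C$; thus $B^*$ consists of the maximal members
  of $B \cup D(B)$.

  The set $D(A)$ has a description without infinite collections (\<open>D_ideals_iff\<close>): a nonzero
  ideal $d$ is in $D(A)$ iff for \<^emph>\<open>every\<close> nonzero ideal $s$ there is a proper ideal $c$ coprime to
  $s$ with $dc \in A$. One direction holds because only finitely many members of a pairwise coprime
  collection fail to be coprime to $s$; the other builds $C$ one ideal at a time.

  Applying it twice gives $D(B^*) = \emptyset$ (\<open>D_ideals_star\<close>): if $d$ were in it, the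
  products $dc$ in $B^*$ could be multiplied further into $B$, so $d$ would lie in $D(B)$ and
  strictly above some member $dc$ of $B^*$, against maximality.

  If $D(A) = \emptyset$, then every $g$ outside the multiples of $A$ has a whole coset $g + s$
  outside them (\<open>free_coset_if_no_D_ideals\<close>). If not, then for each $s$ some $b \in A$ meets
  $g + gs$, and $d = b + gs$ contains $g$. Since containment of ideals is divisibility, $b = dc$, and
  $c$ turns out to be proper and coprime to $s$. As only finitely many ideals contain $g$, one $d$
  serves all $s$, that is, $d \in D(A)$. With the trivial statement for multiples this makes
  $\eta^*$ a Toeplitz array.

  Conversely, any finite pattern of $\eta^*$ occurs in $\eta$ along a whole coset of a nonzero ideal
  (\<open>eta_star_pattern_in_eta\<close>): ones are stable under small shifts by the Toeplitz argument, and a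
  zero at $h \in d \in D(B)$ is produced by moving $h$ into some $dc \in B$, where $c$ is coprime to
  everything arranged so far, as in the Chinese remainder theorem. Such a coset has
  bounded gaps, so $\eta^*$ lies in the orbit closure of every $y \in X_\eta$, and
  the statements about minimal sets are formal consequences.

  The arithmetic input is that nonzero ideals have finite index and are invertible. The ring $R/pR$
  is finite since elements independent modulo a prime $p$ are independent over the rationals
  (\<open>finite_index_prime\<close>). Finiteness then yields invertibility (\<open>ideal_invertible\<close>): in a finite
  quotient every proper ideal has a nonzero annihilator, and a multiplier of a nonzero ideal is
  integral because two of its powers agree modulo a finite-index ideal.
\<close>

section \<open>Algebraic integers form a ring\<close>

text \<open>The additive structure of the field as a module over the integers. A separate constant
  keeps the module laws away from ordinary products.\<close>

definition int_scale :: "int \<Rightarrow> 'k::field_char_0 \<Rightarrow> 'k" where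
  "int_scale n x = of_int n * x"

interpretation zmod: Modules.module "int_scale :: int \<Rightarrow> 'k::field_char_0 \<Rightarrow> 'k"
  by unfold_locales (auto simp: int_scale_def algebra_simps)

text \<open>Multiplication by $z$ acts on the generators through an integer matrix, which has the
  vector of generators as an eigenvector with eigenvalue $z$. So $z$ is a root of the
  characteristic polynomial, which is monic with integer coefficients.\<close>

lemma algebraic_int_if_stable_module:
  fixes z :: "'k::field_char_0"
  assumes fin: "finite V" and nz: "v0 \<in> V" "v0 \<noteq> 0"
    and stable: "\<And>v. v \<in> V \<Longrightarrow> z * v \<in> zmod.span V"
  shows "algebraic_int z"
proof -
  obtain vs where vs: "set vs = V" "distinct vs"
    using fin finite_distinct_list by blast
  define n where "n = length vs"
  have "\<exists>u. z * v = (\<Sum>w\<in>V. of_int (u w) * w)" if "v \<in> V" for v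
    using stable[OF that] unfolding zmod.span_finite[OF fin] by (auto simp: int_scale_def)
  then obtain u where u: "\<And>v. v \<in> V \<Longrightarrow> z * v = (\<Sum>w\<in>V. of_int (u v w :: int) * w)"
    by metis
  define A where "A = mat n n (\<lambda>(i, j). u (vs ! i) (vs ! j))"
  let ?A = "map_mat of_int A :: 'k mat"
  define x where "x = vec n (\<lambda>i. vs ! i)"
  have A: "A \<in> carrier_mat n n" "?A \<in> carrier_mat n n" and x: "x \<in> carrier_vec n"
    by (auto simp: A_def x_def)
  have bij: "bij_betw ((!) vs) {..<n} V"
    using bij_betw_nth[OF vs(2)] vs(1) by (simp add: n_def)
  have "?A *\<^sub>v x = z \<cdot>\<^sub>v x"
  proof (rule eq_vecI)
    fix i assume "i < dim_vec (z \<cdot>\<^sub>v x)"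
    then have i: "i < n" by (simp add: x_def)
    have "(?A *\<^sub>v x) $ i = (\<Sum>j\<in>{..<n}. of_int (u (vs ! i) (vs ! j)) * vs ! j)"
      using i by (auto simp: scalar_prod_def A_def x_def atLeast0LessThan intro!: sum.cong)
    also have "\<dots> = (\<Sum>w\<in>V. of_int (u (vs ! i) w) * w)"
      using sum.reindex_bij_betw[OF bij, of "\<lambda>w. of_int (u (vs ! i) w) * w"] by simp
    also have "\<dots> = z * vs ! i"
      using u[of "vs ! i"] i vs(1) by (auto simp: n_def)
    finally show "(?A *\<^sub>v x) $ i = (z \<cdot>\<^sub>v x) $ i"
      using i by (simp add: x_def)
  qed (auto simp: A_def x_def)
  moreover have "x \<noteq> 0\<^sub>v n"
  proof -
    obtain i where i: "i < n" "vs ! i = v0"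
      using nz(1) vs(1) by (auto simp: n_def in_set_conv_nth)
    then have "x $ i \<noteq> 0\<^sub>v n $ i" using nz(2) by (simp add: x_def)
    then show ?thesis by auto
  qed
  ultimately have "eigenvector ?A x z"
    using x A by (auto simp: eigenvector_def)
  then have "eigenvalue ?A z" by (auto simp: eigenvalue_def)
  then have "poly (char_poly ?A) z = 0" using eigenvalue_root_char_poly[OF A(2)] by blast
  then have "poly (map_poly of_int (char_poly A)) z = 0"
    unfolding of_int_hom.char_poly_hom[OF A(1)] .
  moreover have "lead_coeff (char_poly A) = 1"
    using degree_monic_char_poly[OF A(1)] by simp
  ultimately show ?thesis unfolding algebraic_int_altdef_ipoly by blast
qed

lemma algebraic_int_imp_power_eq:
  fixes x :: "'k::field_char_0"
  assumes "algebraic_int x"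
  obtains m and c :: "nat \<Rightarrow> int" where "m > 0" "x ^ m = (\<Sum>i<m. of_int (c i) * x ^ i)"
proof -
  obtain p where p: "poly (map_poly of_int p) x = 0" "lead_coeff p = 1"
    using assms unfolding algebraic_int_altdef_ipoly by blast
  define m where "m = degree p"
  have "0 = (\<Sum>i\<le>m. of_int (coeff p i) * x ^ i)"
    using p(1) by (simp add: poly_altdef m_def degree_map_poly coeff_map_poly)
  also have "\<dots> = (\<Sum>i<m. of_int (coeff p i) * x ^ i) + x ^ m"
    using p(2) by (simp add: m_def lessThan_Suc_atMost[symmetric])
  finally have "x ^ m = - (\<Sum>i<m. of_int (coeff p i) * x ^ i)"
    by (metis add_eq_0_iff)
  then have *: "x ^ m = (\<Sum>i<m. of_int (- coeff p i) * x ^ i)"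
    by (simp only: of_int_minus mult_minus_left sum_negf)
  moreover have "m \<noteq> 0"
  proof
    assume "m = 0"
    with * show False by simp
  qed
  ultimately show ?thesis using that[of m "\<lambda>i. - coeff p i"] by blast
qed

text \<open>The monomials $x^i y^j$ below the degrees of monic equations for $x$ and $y$ generate
  a module that is stable under both elements, hence under their sum and their product.\<close>

lemma algebraic_int_common_stable_module:
  fixes x y :: "'k::field_char_0"
  assumes "algebraic_int x" "algebraic_int y"
  obtains V where "finite V" "1 \<in> V"
    "\<And>v. v \<in> zmod.span V \<Longrightarrow> x * v \<in> zmod.span V"
    "\<And>v. v \<in> zmod.span V \<Longrightarrow> y * v \<in> zmod.span V"
proof -
  obtain m c where m: "m > 0" "x ^ m = (\<Sum>i<m. of_int (c i :: int) * x ^ i)"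
    using algebraic_int_imp_power_eq[OF assms(1)] by blast
  obtain n d where n: "n > 0" "y ^ n = (\<Sum>i<n. of_int (d i :: int) * y ^ i)"
    using algebraic_int_imp_power_eq[OF assms(2)] by blast
  define V where "V = (\<lambda>(i, j). x ^ i * y ^ j) ` ({..<m} \<times> {..<n})"
  have V: "x ^ i * y ^ j \<in> zmod.span V" if "i < m" "j < n" for i j
    using that by (intro zmod.span_base) (auto simp: V_def)
  have xV: "x * v \<in> zmod.span V" if "v \<in> zmod.span V" for v
    using that
  proof (induction rule: zmod.span_induct_alt)
    case (step k v w)
    then obtain i j where ij: "v = x ^ i * y ^ j" "i < m" "j < n" by (auto simp: V_def)
    have "x * v \<in> zmod.span V"
    proof (cases "Suc i < m")
      case True
      then show ?thesis using V[of "Suc i" j] ij by (simp add: mult.assoc)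
    next
      case False
      with ij have "x * v = x ^ m * y ^ j" by (cases m) (auto simp: less_Suc_eq)
      also have "\<dots> = (\<Sum>i<m. int_scale (c i) (x ^ i * y ^ j))"
        by (simp add: m(2) sum_distrib_right mult.assoc int_scale_def)
      also have "\<dots> \<in> zmod.span V"
        using ij V by (intro zmod.span_sum zmod.span_scale) auto
      finally show ?thesis .
    qed
    then have "int_scale k (x * v) + x * w \<in> zmod.span V"
      using step by (intro zmod.span_add zmod.span_scale)
    moreover have "int_scale k (x * v) + x * w = x * (int_scale k v + w)"
      by (simp add: int_scale_def algebra_simps)
    ultimately show ?case by simp
  qed (simp add: zmod.span_zero)
  have yV: "y * v \<in> zmod.span V" if "v \<in> zmod.span V" for v
    using that
  proof (induction rule: zmod.span_induct_alt)
    case (step k v w)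
    then obtain i j where ij: "v = x ^ i * y ^ j" "i < m" "j < n" by (auto simp: V_def)
    have "y * v \<in> zmod.span V"
    proof (cases "Suc j < n")
      case True
      then show ?thesis using V[of i "Suc j"] ij by (simp add: mult.left_commute)
    next
      case False
      with ij have "y * v = x ^ i * y ^ n" by (cases n) (auto simp: less_Suc_eq)
      also have "\<dots> = (\<Sum>j<n. int_scale (d j) (x ^ i * y ^ j))"
        by (simp add: n(2) sum_distrib_left mult.left_commute int_scale_def)
      also have "\<dots> \<in> zmod.span V"
        using ij V by (intro zmod.span_sum zmod.span_scale) auto
      finally show ?thesis .
    qed
    then have "int_scale k (y * v) + y * w \<in> zmod.span V"
      using step by (intro zmod.span_add zmod.span_scale)
    moreover have "int_scale k (y * v) + y * w = y * (int_scale k v + w)"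
      by (simp add: int_scale_def algebra_simps)
    ultimately show ?case by simp
  qed (simp add: zmod.span_zero)
  have "1 \<in> V" using m(1) n(1) by (force simp: V_def image_iff)
  moreover have "finite V" by (simp add: V_def)
  ultimately show ?thesis using that xV yV by blast
qed

lemma algebraic_int_add:
  fixes x y :: "'k::field_char_0"
  assumes "algebraic_int x" "algebraic_int y"
  shows "algebraic_int (x + y)"
proof -
  obtain V where V: "finite V" "1 \<in> V"
    "\<And>v. v \<in> zmod.span V \<Longrightarrow> x * v \<in> zmod.span V"
    "\<And>v. v \<in> zmod.span V \<Longrightarrow> y * v \<in> zmod.span V"
    using algebraic_int_common_stable_module[OF assms] by blast
  show ?thesis
  proof (rule algebraic_int_if_stable_module[OF V(1,2)])
    fix v assume "v \<in> V"
    then have "v \<in> zmod.span V" by (rule zmod.span_base)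
    then show "(x + y) * v \<in> zmod.span V"
      unfolding distrib_right by (intro zmod.span_add V)
  qed simp
qed

lemma algebraic_int_mult:
  fixes x y :: "'k::field_char_0"
  assumes "algebraic_int x" "algebraic_int y"
  shows "algebraic_int (x * y)"
proof -
  obtain V where V: "finite V" "1 \<in> V"
    "\<And>v. v \<in> zmod.span V \<Longrightarrow> x * v \<in> zmod.span V"
    "\<And>v. v \<in> zmod.span V \<Longrightarrow> y * v \<in> zmod.span V"
    using algebraic_int_common_stable_module[OF assms] by blast
  show ?thesis
  proof (rule algebraic_int_if_stable_module[OF V(1,2)])
    fix v assume "v \<in> V"
    then have "v \<in> zmod.span V" by (rule zmod.span_base)
    then show "x * y * v \<in> zmod.span V"
      unfolding mult.assoc by (intro V)
  qed simp
qed

lemma algebraic_int_diff: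
  fixes x y :: "'k::field_char_0"
  shows "algebraic_int x \<Longrightarrow> algebraic_int y \<Longrightarrow> algebraic_int (x - y)"
  using algebraic_int_add[of x "- y"] by simp

lemma algebraic_int_sum:
  fixes f :: "'a \<Rightarrow> 'k::field_char_0"
  assumes "\<And>i. i \<in> A \<Longrightarrow> algebraic_int (f i)"
  shows "algebraic_int (sum f A)"
  using assms by (induction A rule: infinite_finite_induct) (auto intro: algebraic_int_add)

lemma algebraic_int_power:
  fixes x :: "'k::field_char_0"
  shows "algebraic_int x \<Longrightarrow> algebraic_int (x ^ n)"
  by (induction n) (auto intro: algebraic_int_mult)

section \<open>Ideals of the ring of integers\<close>

lemma OK_simps [simp]:
  "x \<in> carrier OK \<longleftrightarrow> algebraic_int x"
  "x \<otimes>\<^bsub>OK\<^esub> y = x * y" "x \<oplus>\<^bsub>OK\<^esub> y = x + y" "\<one>\<^bsub>OK\<^esub> = 1" "\<zero>\<^bsub>OK\<^esub> = 0"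
  by (simp_all add: OK_def)

lemma cring_OK: "cring (OK :: 'k::field_char_0 ring)"
proof (rule cringI)
  show "abelian_group (OK :: 'k ring)"
  proof (rule abelian_groupI)
    fix x :: 'k
    assume "x \<in> carrier OK"
    then show "\<exists>y\<in>carrier OK. y \<oplus>\<^bsub>OK\<^esub> x = \<zero>\<^bsub>OK\<^esub>"
      by (intro bexI[of _ "- x"]) auto
  qed (auto intro: algebraic_int_add simp: algebra_simps)
  show "comm_monoid (OK :: 'k ring)"
    by unfold_locales (auto intro: algebraic_int_mult simp: algebra_simps)
qed (simp add: algebra_simps)

interpretation OK: cring "OK :: 'k::field_char_0 ring"
  by (rule cring_OK)

lemma a_inv_OK [simp]: "algebraic_int x \<Longrightarrow> \<ominus>\<^bsub>OK\<^esub> x = - x"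
  by (rule OK.minus_equality) auto

lemma additive_subgroup_OK_iff:
  "additive_subgroup S OK \<longleftrightarrow>
     S \<subseteq> carrier OK \<and> 0 \<in> S \<and> (\<forall>a\<in>S. \<forall>b\<in>S. a + b \<in> S) \<and> (\<forall>a\<in>S. - a \<in> S)" (is "?L \<longleftrightarrow> ?R")
proof
  assume ?L
  then interpret additive_subgroup S OK .
  have "- a \<in> S" if "a \<in> S" for a
    using a_inv_closed[OF that] a_Hcarr[OF that] by simp
  then show ?R
    using zero_closed a_closed a_subset by auto
next
  assume R: ?R
  show ?L
  proof
    show "inv\<^bsub>add_monoid OK\<^esub> a \<in> S" if "a \<in> S" for a
      using R that a_inv_OK[of a] by (auto simp: a_inv_def)
  qed (use R in \<open>auto simp: OK_def\<close>)
qed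

lemma ideal_OK_iff:
  "ideal I OK \<longleftrightarrow>
     I \<subseteq> carrier OK \<and> 0 \<in> I \<and> (\<forall>a\<in>I. \<forall>b\<in>I. a + b \<in> I) \<and>
     (\<forall>a\<in>I. \<forall>r. algebraic_int r \<longrightarrow> r * a \<in> I)" (is "?L \<longleftrightarrow> ?R")
proof
  assume ?L
  then interpret ideal I OK .
  show ?R
    using I_l_closed zero_closed a_closed a_subset by fastforce
next
  assume R: ?R
  then have "- a \<in> I" if "a \<in> I" for a
    using that algebraic_int_minus[OF algebraic_int_1] by force
  with R have "additive_subgroup I OK"
    by (auto simp: additive_subgroup_OK_iff)
  then show ?L
    by (intro idealI) (use R in \<open>auto simp: mult.commute OK.ring_axioms additive_subgroup_def\<close>)
qed

lemma ideal_OK_I: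
  assumes "\<And>a. a \<in> I \<Longrightarrow> algebraic_int a" "0 \<in> I"
    and "\<And>a b. a \<in> I \<Longrightarrow> b \<in> I \<Longrightarrow> a + b \<in> I"
    and "\<And>r a. algebraic_int r \<Longrightarrow> a \<in> I \<Longrightarrow> r * a \<in> I"
  shows "ideal I OK"
  using assms by (auto simp: ideal_OK_iff)

lemma ideal_algebraic_int: "ideal I OK \<Longrightarrow> a \<in> I \<Longrightarrow> algebraic_int a"
  and ideal_zero: "ideal I OK \<Longrightarrow> 0 \<in> I"
  and ideal_add: "ideal I OK \<Longrightarrow> a \<in> I \<Longrightarrow> b \<in> I \<Longrightarrow> a + b \<in> I"
  and ideal_lmult: "ideal I OK \<Longrightarrow> a \<in> I \<Longrightarrow> algebraic_int r \<Longrightarrow> r * a \<in> I"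
  and ideal_rmult: "ideal I OK \<Longrightarrow> a \<in> I \<Longrightarrow> algebraic_int r \<Longrightarrow> a * r \<in> I"
  by (auto simp: ideal_OK_iff mult.commute)

lemma ideal_minus: "ideal I OK \<Longrightarrow> a \<in> I \<Longrightarrow> - a \<in> I"
  using ideal_lmult[of I a "- 1"] by simp

lemma ideal_diff: "ideal I OK \<Longrightarrow> a \<in> I \<Longrightarrow> b \<in> I \<Longrightarrow> a - b \<in> I"
  using ideal_add[of I a "- b"] ideal_minus[of I b] by simp

lemma ideal_carrier: "ideal (carrier OK) OK"
  by (rule OK.oneideal)

lemma ideal_eq_carrier_iff: "ideal I OK \<Longrightarrow> I = carrier OK \<longleftrightarrow> 1 \<in> I"
  using ideal_rmult[of I 1] by (auto dest: ideal_algebraic_int)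

lemma set_add_OK: "I <+>\<^bsub>OK\<^esub> J = {x + y | x y. x \<in> I \<and> y \<in> J}"
  by (auto simp: set_add_def set_mult_def OK_def)

lemma ideal_set_add: "ideal I OK \<Longrightarrow> ideal J OK \<Longrightarrow> ideal (I <+>\<^bsub>OK\<^esub> J) OK"
  by (rule OK.add_ideals)

lemma set_add_eq_carrier_iff:
  assumes "ideal I OK" "ideal J OK"
  shows "I <+>\<^bsub>OK\<^esub> J = carrier OK \<longleftrightarrow> (\<exists>x\<in>I. \<exists>y\<in>J. x + y = 1)"
proof -
  have "I <+>\<^bsub>OK\<^esub> J = carrier OK \<longleftrightarrow> 1 \<in> I <+>\<^bsub>OK\<^esub> J"
    by (rule ideal_eq_carrier_iff[OF ideal_set_add[OF assms]])
  also have "\<dots> \<longleftrightarrow> (\<exists>x\<in>I. \<exists>y\<in>J. x + y = 1)"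
    unfolding set_add_OK by (simp add: eq_commute[of 1]) blast
  finally show ?thesis .
qed

definition principal :: "'k::field_char_0 \<Rightarrow> 'k set" where
  "principal a = (\<lambda>r. a * r) ` carrier OK"

lemma mem_principal: "x \<in> principal a \<longleftrightarrow> (\<exists>r. algebraic_int r \<and> x = a * r)"
  by (auto simp: principal_def)

lemma mult_mem_principal: "algebraic_int r \<Longrightarrow> a * r \<in> principal a"
  by (auto simp: mem_principal)

lemma ideal_principal:
  fixes a :: "'k::field_char_0"
  assumes "algebraic_int a"
  shows "ideal (principal a) OK"
proof (rule ideal_OK_I)
  fix x y assume "x \<in> principal a" "y \<in> principal a"
  then obtain r s where "algebraic_int r" "x = a * r" "algebraic_int s" "y = a * s"
    unfolding mem_principal by blast
  then show "x + y \<in> principal a"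
    unfolding mem_principal
    by (intro exI[of _ "r + s"]) (simp add: algebraic_int_add distrib_left)
next
  fix r x :: 'k
  assume r: "algebraic_int r" and "x \<in> principal a"
  then obtain s where "algebraic_int s" "x = a * s" unfolding mem_principal by blast
  with r show "r * x \<in> principal a"
    unfolding mem_principal by (intro exI[of _ "r * s"]) (simp add: algebraic_int_mult)
next
  show "0 \<in> principal a" unfolding mem_principal by (intro exI[of _ 0]) simp
next
  fix x assume "x \<in> principal a"
  then show "algebraic_int x" unfolding mem_principal using assms by (auto intro: algebraic_int_mult)
qed

lemma self_mem_principal: "a \<in> principal a"
  by (auto simp: mem_principal)

lemma principal_subset: "ideal I OK \<Longrightarrow> a \<in> I \<Longrightarrow> principal a \<subseteq> I"
  by (auto simp: mem_principal intro: ideal_rmult)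

lemma nonzero_idealD: "nonzero_ideal I \<Longrightarrow> ideal I OK"
  by (simp add: nonzero_ideal_def)

lemma nonzero_ideal_iff: "nonzero_ideal I \<longleftrightarrow> ideal I OK \<and> (\<exists>a\<in>I. a \<noteq> 0)"
  using ideal_zero[of I] by (auto simp: nonzero_ideal_def)

lemma nonzero_ideal_mono: "nonzero_ideal I \<Longrightarrow> I \<subseteq> J \<Longrightarrow> ideal J OK \<Longrightarrow> nonzero_ideal J"
  by (auto simp: nonzero_ideal_iff)

lemma nonzero_ideal_carrier: "nonzero_ideal (carrier OK)"
  unfolding nonzero_ideal_iff using ideal_carrier by (auto intro!: bexI[of _ 1])

lemma nonzero_ideal_principal: "algebraic_int a \<Longrightarrow> a \<noteq> 0 \<Longrightarrow> nonzero_ideal (principal a)"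
  unfolding nonzero_ideal_iff using ideal_principal self_mem_principal by blast

section \<open>Nonzero ideals have finite index\<close>

text \<open>Finite index is expressed by a finite set of representatives, because the
  representatives themselves are what the pigeonhole and recurrence arguments work with.\<close>

definition finite_index :: "'k::field_char_0 set \<Rightarrow> bool" where
  "finite_index S \<longleftrightarrow>
     (\<exists>F. finite F \<and> F \<subseteq> carrier OK \<and> (\<forall>x\<in>carrier OK. \<exists>f\<in>F. x - f \<in> S))"

lemma finite_index_mono: "finite_index S \<Longrightarrow> S \<subseteq> T \<Longrightarrow> finite_index T"
  unfolding finite_index_def by (meson subsetD)

lemma common_denominator:
  fixes c :: "'a \<Rightarrow> rat"
  assumes "finite T"
  shows "\<exists>N::int. N \<noteq> 0 \<and> (\<forall>v\<in>T. \<exists>d::int. of_int N * c v = of_int d)"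
  using assms
proof (induction T)
  case (insert v T)
  then obtain N :: int where N: "N \<noteq> 0" "\<forall>v\<in>T. \<exists>d::int. of_int N * c v = of_int d" by blast
  obtain a b where ab: "c v = of_int a / of_int b" "b > 0"
    by (cases "c v" rule: Rat_cases) (auto simp: Fract_of_int_quotient)
  have "\<exists>d::int. of_int (N * b) * c w = of_int d" if w: "w \<in> insert v T" for w
  proof (cases "w \<in> T")
    case True
    with N obtain d :: int where "of_int N * c w = of_int d" by blast
    then have "of_int (N * b) * c w = of_int (d * b)" by (simp add: mult_ac)
    then show ?thesis by blast
  next
    case False
    with w ab have "of_int (N * b) * c w = of_int (N * a)" by simp
    then show ?thesis by blast
  qed
  with N(1) ab(2) show ?case by (intro exI[of _ "N * b"]) auto
qed (auto intro: exI[of _ 1])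

text \<open>A set of algebraic integers that is independent modulo $p$ is independent over the
  rationals: in an integral relation all coefficients are divisible by $p$, and dividing by $p$
  repeatedly forces them to vanish. Hence such sets have at most as many elements as the degree of
  the field, and one of maximal size spans the ring modulo $p$.\<close>

lemma finite_index_prime:
  assumes nf: "number_field TYPE('k::field_char_0)" and p: "Factorial_Ring.prime (p::int)"
  shows "finite_index (principal (of_int p :: 'k))"
proof -
  obtain Bs :: "'k set" where
    fd: "finite_dimensional_vector_space (\<lambda>(q::rat) (x::'k). of_rat q * x) Bs"
    using nf unfolding number_field_def by blast
  interpret V: finite_dimensional_vector_space "\<lambda>(q::rat) (x::'k). of_rat q * x" Bs
    by (rule fd)
  define P where "P = principal (of_int p :: 'k)"
  have P: "ideal P OK" unfolding P_def by (rule ideal_principal) simp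
  define comb where "comb c T = (\<Sum>t\<in>T. of_int (c t :: int) * t)" for c and T :: "'k set"
  define indep where "indep T \<longleftrightarrow> finite T \<and> T \<subseteq> carrier OK \<and>
      (\<forall>c. comb c T \<in> P \<longrightarrow> (\<forall>t\<in>T. p dvd c t))" for T
  \<comment> \<open>infinite descent on the size of a coefficient\<close>
  have desc: "c v = 0" if T: "indep T" and v: "v \<in> T" and c: "comb c T = 0" for T c v
    using c
  proof (induction "nat \<bar>c v\<bar>" arbitrary: c rule: less_induct)
    case less
    have "p dvd c t" if "t \<in> T" for t
      using T less.prems that ideal_zero[OF P] by (auto simp: indep_def)
    then have c': "c t = p * (c t div p)" if "t \<in> T" for t using that by simp
    define c' where "c' = (\<lambda>t. c t div p)"
    have "comb c T = of_int p * comb c' T"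
      unfolding comb_def sum_distrib_left mult.assoc[symmetric] of_int_mult[symmetric]
      using c' by (intro sum.cong) (auto simp: c'_def)
    with less.prems p have "comb c' T = 0" by auto
    moreover have "nat \<bar>c' v\<bar> < nat \<bar>c v\<bar>" if nz: "c v \<noteq> 0"
    proof -
      have cv: "c v = p * c' v" using c'[OF v] by (simp add: c'_def)
      then have "\<bar>c v\<bar> = p * \<bar>c' v\<bar>" "c' v \<noteq> 0"
        using nz prime_gt_0_int[OF p] by (auto simp: abs_mult)
      moreover have "p \<ge> 2" using p by (rule prime_ge_2_int)
      then have "1 * \<bar>c' v\<bar> < p * \<bar>c' v\<bar>"
        using \<open>c' v \<noteq> 0\<close> by (intro mult_strict_right_mono) auto
      ultimately show ?thesis by simp
    qed
    ultimately have "c v = 0 \<or> c' v = 0" using less.hyps[of c'] by blast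
    then show ?case using c'[OF v] by (auto simp: c'_def)
  qed
  have "V.independent T" if T: "indep T" for T
    unfolding V.independent_explicit
  proof (intro conjI allI impI ballI)
    show fin: "finite T" using T by (simp add: indep_def)
    fix c :: "'k \<Rightarrow> rat" and v
    assume c: "(\<Sum>v\<in>T. of_rat (c v) * v) = 0" and v: "v \<in> T"
    obtain N d where N: "N \<noteq> 0" and d: "\<forall>v\<in>T. of_int N * c v = of_int (d v :: int)"
      using common_denominator[OF fin, of c] by metis
    have "comb d T = (\<Sum>v\<in>T. of_rat (of_int N * c v) * v)"
      unfolding comb_def using d by (intro sum.cong) auto
    also have "\<dots> = of_int N * (\<Sum>v\<in>T. of_rat (c v) * v)"
      by (simp add: of_rat_mult sum_distrib_left mult.assoc)
    finally have "comb d T = 0" using c by simp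
    then have "d v = 0" using desc[OF T v] by blast
    with d v N show "c v = 0" by fastforce
  qed
  then have bound: "card T \<le> V.dim UNIV" if "indep T" for T
    using that V.independent_card_le_dim[of T UNIV] by blast
  have "indep {}" by (simp add: indep_def)
  then obtain T where T: "indep T" and max: "\<And>T'. indep T' \<Longrightarrow> card T' \<le> card T"
    using ex_has_greatest_nat[of indep "{}" card "Suc (V.dim UNIV)"] bound
    by (auto simp: less_Suc_eq_le)
  have fin: "finite T" and T_OK: "T \<subseteq> carrier OK" using T by (auto simp: indep_def)
  define F where "F = (\<lambda>c. comb c T) ` (T \<rightarrow>\<^sub>E {0..<p})"
  have OK_comb: "algebraic_int (comb c T)" for c
    unfolding comb_def using T_OK
    by (auto intro!: algebraic_int_sum algebraic_int_mult)
  have P_comb: "comb c T \<in> P" if "\<And>t. t \<in> T \<Longrightarrow> p dvd c t" for c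
  proof -
    have "comb c T = of_int p * comb (\<lambda>t. c t div p) T"
      unfolding comb_def sum_distrib_left mult.assoc[symmetric] of_int_mult[symmetric]
      using that by (intro sum.cong) auto
    then show ?thesis unfolding P_def using OK_comb by (simp add: mult_mem_principal)
  qed
  have span: "\<exists>c. x - comb c T \<in> P" if x: "algebraic_int x" for x
  proof (cases "x \<in> T")
    case True
    have "comb (\<lambda>t. if t = x then 1 else 0) T = (\<Sum>t\<in>T. if t = x then t else 0)"
      unfolding comb_def by (intro sum.cong) auto
    also have "\<dots> = x" using True fin by simp
    finally show ?thesis using ideal_zero[OF P] by (metis diff_self)
  next
    case False
    have comb_insert: "comb c (insert x T) = of_int (c x) * x + comb c T" for c
      unfolding comb_def using fin False by simp
    have "\<not> indep (insert x T)"
      using max[of "insert x T"] fin False by auto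
    then obtain c t where c: "comb c (insert x T) \<in> P" "t \<in> insert x T" "\<not> p dvd c t"
      using fin T_OK x by (auto simp: indep_def)
    have "\<not> p dvd c x"
    proof
      assume dvd: "p dvd c x"
      then have "of_int (c x) * x = of_int p * (of_int (c x div p) * x)"
        by (simp flip: of_int_mult mult.assoc)
      moreover have "of_int p * (of_int (c x div p) * x) \<in> P"
        unfolding P_def using x by (simp add: mult_mem_principal algebraic_int_mult)
      ultimately have "of_int (c x) * x \<in> P" by metis
      from ideal_diff[OF P c(1) this] have "comb c T \<in> P"
        unfolding comb_insert by simp
      then show False using T c(2,3) dvd by (auto simp: indep_def)
    qed
    with p have "coprime (c x) p"
      by (metis coprime_commute prime_imp_coprime)
    then obtain u where "[c x * u = 1] (mod p)"
      using cong_solve_coprime_int by blast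
    then obtain k where k: "c x * u = 1 + p * k"
      by (metis cong_iff_lin cong_sym)
    \<comment> \<open>solve the relation modulo \<open>p\<close> for \<open>x\<close>, whose coefficient has inverse \<open>u\<close>\<close>
    have comb_u: "comb (\<lambda>t. - u * c t) T = - of_int u * comb c T"
      unfolding comb_def sum_distrib_left by (intro sum.cong) auto
    have "of_int u * comb c (insert x T) = of_int (c x * u) * x + of_int u * comb c T"
      unfolding comb_insert by (simp add: algebra_simps)
    also have "\<dots> = x + of_int p * (of_int k * x) - comb (\<lambda>t. - u * c t) T"
      unfolding k comb_u by (simp add: algebra_simps)
    finally have "x - comb (\<lambda>t. - u * c t) T =
        of_int u * comb c (insert x T) - of_int p * (of_int k * x)"
      by simp
    also have "\<dots> \<in> P"
    proof (rule ideal_diff[OF P])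
      show "of_int u * comb c (insert x T) \<in> P" using c(1) by (intro ideal_lmult[OF P]) auto
      show "of_int p * (of_int k * x) \<in> P"
        unfolding P_def using x by (simp add: mult_mem_principal algebraic_int_mult)
    qed
    finally show ?thesis by blast
  qed
  have "\<exists>f\<in>F. x - f \<in> P" if x: "algebraic_int x" for x
  proof -
    obtain c where c: "x - comb c T \<in> P" using span[OF x] by blast
    have "comb (\<lambda>t. c t - c t mod p) T \<in> P" by (rule P_comb) simp
    with c have "x - comb c T + comb (\<lambda>t. c t - c t mod p) T \<in> P"
      by (intro ideal_add[OF P])
    also have "x - comb c T + comb (\<lambda>t. c t - c t mod p) T =
        x - comb (restrict (\<lambda>t. c t mod p) T) T"
      unfolding comb_def by (simp add: algebra_simps sum_subtractf)
    finally have "x - comb (restrict (\<lambda>t. c t mod p) T) T \<in> P" .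
    moreover have "restrict (\<lambda>t. c t mod p) T \<in> T \<rightarrow>\<^sub>E {0..<p}"
      using prime_gt_0_int[OF p] by auto
    ultimately show ?thesis unfolding F_def by blast
  qed
  moreover have "finite F" unfolding F_def using fin by (intro finite_imageI finite_PiE) auto
  moreover have "F \<subseteq> carrier OK" unfolding F_def using OK_comb by auto
  ultimately show ?thesis unfolding finite_index_def P_def by (intro exI[of _ F]) auto
qed

text \<open>Representatives modulo $pn$ are $f + pg$ with $f$ running modulo $p$ and $g$ modulo
  $n$.\<close>

lemma finite_index_of_int:
  assumes nf: "number_field TYPE('k::field_char_0)" and n: "n \<noteq> 0"
  shows "finite_index (principal (of_int n :: 'k))"
  using n
proof (induction n rule: prime_divisors_induct)
  case (unit n)
  then have "n = 1 \<or> n = - 1" by auto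
  then have "x \<in> principal (of_int n)" if "algebraic_int x" for x :: 'k
    using that unfolding mem_principal
    by (intro exI[of _ "of_int n * x"]) auto
  then show ?case
    unfolding finite_index_def by (intro exI[of _ "{0}"]) auto
next
  case (factor p n)
  obtain F :: "'k set" where F: "finite F" "F \<subseteq> carrier OK"
    "\<And>x. algebraic_int x \<Longrightarrow> \<exists>f\<in>F. x - f \<in> principal (of_int p)"
    using finite_index_prime[OF nf factor.hyps] unfolding finite_index_def by auto
  obtain G :: "'k set" where G: "finite G" "G \<subseteq> carrier OK"
    "\<And>x. algebraic_int x \<Longrightarrow> \<exists>g\<in>G. x - g \<in> principal (of_int n)"
    using factor unfolding finite_index_def by auto
  define H where "H = (\<lambda>(f, g). f + of_int p * g) ` (F \<times> G)"
  have "\<exists>h\<in>H. x - h \<in> principal (of_int (p * n))" if x: "algebraic_int x" for x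
  proof -
    obtain f y where y: "f \<in> F" "algebraic_int y" "x - f = of_int p * y"
      using F(3)[OF x] by (auto simp: mem_principal)
    obtain g z where z: "g \<in> G" "algebraic_int z" "y - g = of_int n * z"
      using G(3)[OF y(2)] by (auto simp: mem_principal)
    have "x - (f + of_int p * g) = of_int p * (y - g)"
      using y(3) by (simp add: algebra_simps)
    also have "\<dots> = of_int (p * n) * z" unfolding z(3) by simp
    finally show ?thesis
      using y(1) z(1,2) by (auto simp: H_def mem_principal)
  qed
  moreover have "finite H" "H \<subseteq> carrier OK"
    using F(1,2) G(1,2) by (auto simp: H_def subset_eq intro!: algebraic_int_add algebraic_int_mult)
  ultimately show ?case unfolding finite_index_def by (intro exI[of _ H]) auto
qed simp

lemma algebraic_int_poly:
  fixes x :: "'k::field_char_0"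
  assumes "algebraic_int x"
  shows "algebraic_int (poly (map_poly of_int p) x)"
  by (induction p) (auto simp: map_poly_pCons intro!: algebraic_int_add algebraic_int_mult assms)

text \<open>The witness is the lowest nonzero coefficient of a monic integral equation for
  $x$.\<close>

lemma algebraic_int_dvd_integer:
  fixes x :: "'k::field_char_0"
  assumes "algebraic_int x" "x \<noteq> 0"
  obtains n :: int where "n \<noteq> 0" "of_int n \<in> principal x"
proof -
  obtain p where "poly (map_poly of_int p) x = 0" "lead_coeff p = 1"
    using assms unfolding algebraic_int_altdef_ipoly by blast
  then have "\<exists>n::int. n \<noteq> 0 \<and> of_int n \<in> principal x"
  proof (induction p)
    case (pCons c q)
    then have eq: "of_int c + x * poly (map_poly of_int q) x = 0"
      by (simp add: map_poly_pCons)
    show ?case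
    proof (cases "c = 0")
      case True
      with eq assms(2) have "poly (map_poly of_int q) x = 0" by simp
      moreover have "lead_coeff q = 1" using pCons.prems(2) pCons.hyps True by (auto split: if_splits)
      ultimately show ?thesis using pCons.IH by blast
    next
      case False
      from eq have "of_int c = x * (- poly (map_poly of_int q) x)"
        by (simp add: eq_neg_iff_add_eq_0)
      then have "of_int c \<in> principal x"
        using algebraic_int_poly[OF assms(1)] by (simp only: mult_mem_principal algebraic_int_minus)
      with False show ?thesis by blast
    qed
  qed simp
  with that show ?thesis by blast
qed

lemma finite_index_nonzero_ideal:
  fixes I :: "'k::field_char_0 set"
  assumes nf: "number_field TYPE('k)" and I: "nonzero_ideal I"
  shows "finite_index I"
proof -
  have I': "ideal I OK" using I by (simp add: nonzero_ideal_def)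
  then obtain a where a: "a \<in> I" "a \<noteq> 0"
    using I ideal_zero[OF I'] unfolding nonzero_ideal_def by blast
  obtain n :: int where n: "n \<noteq> 0" "of_int n \<in> principal a"
    using algebraic_int_dvd_integer[of a] a ideal_algebraic_int[OF I'] by blast
  then have "of_int n \<in> I" using principal_subset[OF I' a(1)] by blast
  from principal_subset[OF I' this] finite_index_of_int[OF nf n(1)]
  show ?thesis by (rule finite_index_mono[rotated])
qed

text \<open>An ideal above $S$ is a union of cosets of $S$, so it is determined by the
  representatives that it contains.\<close>

lemma finite_ideals_above:
  assumes "finite_index S"
  shows "finite {I. ideal I OK \<and> S \<subseteq> I}"
proof -
  obtain F where F: "finite F" "F \<subseteq> carrier OK" "\<And>x. algebraic_int x \<Longrightarrow> \<exists>f\<in>F. x - f \<in> S"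
    using assms unfolding finite_index_def by auto
  have eq: "I = {x. algebraic_int x \<and> (\<exists>f\<in>F \<inter> I. x - f \<in> S)}" if I: "ideal I OK" "S \<subseteq> I" for I
  proof (rule equalityI; rule subsetI)
    fix x assume x: "x \<in> I"
    then obtain f where f: "f \<in> F" "x - f \<in> S" using F(3) ideal_algebraic_int[OF I(1)] by blast
    with I(2) have "x - f \<in> I" by blast
    from ideal_diff[OF I(1) x this] f x show "x \<in> {x. algebraic_int x \<and> (\<exists>f\<in>F \<inter> I. x - f \<in> S)}"
      using ideal_algebraic_int[OF I(1)] by auto
  next
    fix x assume "x \<in> {x. algebraic_int x \<and> (\<exists>f\<in>F \<inter> I. x - f \<in> S)}"
    then obtain f where f: "f \<in> I" "x - f \<in> I" using I(2) by auto
    show "x \<in> I" using ideal_add[OF I(1) f] by simp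
  qed
  have "inj_on (\<lambda>I. F \<inter> I) {I. ideal I OK \<and> S \<subseteq> I}"
  proof (rule inj_onI)
    fix I J
    assume I: "I \<in> {I. ideal I OK \<and> S \<subseteq> I}" and J: "J \<in> {I. ideal I OK \<and> S \<subseteq> I}"
      and "F \<inter> I = F \<inter> J"
    have "I = {x. algebraic_int x \<and> (\<exists>f\<in>F \<inter> I. x - f \<in> S)}" using I by (intro eq) auto
    also have "\<dots> = {x. algebraic_int x \<and> (\<exists>f\<in>F \<inter> J. x - f \<in> S)}"
      by (simp only: \<open>F \<inter> I = F \<inter> J\<close>)
    also have "\<dots> = J" using J by (intro eq[symmetric]) auto
    finally show "I = J" .
  qed
  moreover have "(\<lambda>I. F \<inter> I) ` {I. ideal I OK \<and> S \<subseteq> I} \<subseteq> Pow F" by blast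
  ultimately show ?thesis using F(1) by (meson finite_Pow_iff inj_on_finite)
qed

lemma finite_index_pigeonhole:
  fixes f :: "nat \<Rightarrow> 'k::field_char_0"
  assumes "finite_index S" "ideal S OK" "\<And>n. algebraic_int (f n)"
  obtains i j where "i < j" "f j - f i \<in> S"
proof -
  obtain F where F: "finite F" "F \<subseteq> carrier OK" "\<And>x. algebraic_int x \<Longrightarrow> \<exists>f\<in>F. x - f \<in> S"
    using assms(1) unfolding finite_index_def by auto
  obtain r where r: "\<And>n. r n \<in> F" "\<And>n. f n - r n \<in> S"
    using F(3)[OF assms(3)] by metis
  have "\<not> inj r"
    using F(1) r(1) by (meson finite_subset image_subsetI infinite_UNIV_nat finite_imageD)
  then obtain i j where "r i = r j" "i < j"
    unfolding inj_def by (metis linorder_neqE_nat)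
  moreover have "(f j - r j) - (f i - r i) \<in> S" by (intro ideal_diff assms r)
  ultimately show ?thesis using that by simp
qed

section \<open>Nonzero ideals are invertible\<close>

lemma eventually_periodic_powers:
  fixes S :: "'k::field_char_0 set"
  assumes "finite_index S" "ideal S OK" "algebraic_int x"
  obtains m n where "n > 0" "x ^ m * (1 - x ^ n) \<in> S"
proof -
  obtain i j where ij: "i < j" "x ^ j - x ^ i \<in> S"
    using finite_index_pigeonhole[OF assms(1,2) algebraic_int_power[OF assms(3)]] .
  have "x ^ i * (1 - x ^ (j - i)) = - (x ^ j - x ^ i)"
    using ij(1) by (simp add: right_diff_distrib flip: power_add)
  then show ?thesis
    using that[of "j - i" i] ij ideal_minus[OF assms(2) ij(2)] by simp
qed

text \<open>In the finite ring $R/S$ a proper ideal is annihilated by a nonzero element. Every $x$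
  satisfies $x^m (1 - x^n) = 0$ there for some $m$ and $n > 0$, so the product $u$ of such factors
  $1 - x^n$ over representatives $x$ of $A/S$ is killed by a power of each $x$; and $u$ is
  nonzero, being congruent to $1$ modulo the proper ideal $A$. Multiplying $u$ by the largest
  power of $x$ that does not kill it, one $x$ after the other, gives the annihilator.\<close>

lemma proper_ideal_annihilator:
  fixes S A :: "'k::field_char_0 set"
  assumes fi: "finite_index S" and S: "ideal S OK" and A: "ideal A OK"
    and SA: "S \<subseteq> A" and proper: "1 \<notin> A"
  obtains w where "algebraic_int w" "w \<notin> S" "\<And>x. x \<in> A \<Longrightarrow> w * x \<in> S"
proof -
  have ex_u: "\<exists>u. algebraic_int u \<and> 1 - u \<in> A \<and> (\<forall>x\<in>F. \<exists>k. u * x ^ k \<in> S)"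
    if "finite F" "F \<subseteq> A" for F
    using that
  proof (induction F)
    case empty
    show ?case using ideal_zero[OF A] by (intro exI[of _ 1]) auto
  next
    case (insert x F)
    then obtain u where u: "algebraic_int u" "1 - u \<in> A" "\<And>y. y \<in> F \<Longrightarrow> \<exists>k. u * y ^ k \<in> S"
      by auto
    have x: "x \<in> A" "algebraic_int x" using insert.prems ideal_algebraic_int[OF A] by auto
    obtain m n where mn: "n > 0" "x ^ m * (1 - x ^ n) \<in> S"
      using eventually_periodic_powers[OF fi S x(2)] .
    define e where "e = 1 - x ^ n"
    have e: "algebraic_int e" unfolding e_def
      by (intro algebraic_int_diff algebraic_int_power x algebraic_int_1)
    have "x ^ n = x * x ^ (n - 1)" using mn(1) by (cases n) auto
    then have "x ^ n \<in> A" using ideal_rmult[OF A x(1) algebraic_int_power[OF x(2)]] by simp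
    then have "u * x ^ n \<in> A" using ideal_lmult[OF A _ u(1)] by blast
    with u(2) have "(1 - u) + u * x ^ n \<in> A" by (intro ideal_add[OF A])
    then have "1 - u * e \<in> A" by (simp add: e_def algebra_simps)
    moreover have "\<exists>k. u * e * y ^ k \<in> S" if y: "y \<in> insert x F" for y
    proof (cases "y = x")
      case True
      have "u * (x ^ m * e) \<in> S" using mn(2) u(1) unfolding e_def by (rule ideal_lmult[OF S])
      then have "u * e * x ^ m \<in> S" by (simp add: mult_ac)
      with True show ?thesis by blast
    next
      case False
      with y u(3) obtain k where "u * y ^ k \<in> S" by blast
      then have "e * (u * y ^ k) \<in> S" using e by (rule ideal_lmult[OF S])
      then have "u * e * y ^ k \<in> S" by (simp add: mult_ac)
      then show ?thesis by blast
    qed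
    ultimately show ?case using u(1) e by (intro exI[of _ "u * e"]) (auto intro: algebraic_int_mult)
  qed
  have ex_w: "\<exists>w. algebraic_int w \<and> w \<notin> S \<and> (\<forall>x\<in>F. w * x \<in> S)"
    if F: "finite F" "F \<subseteq> A" for F
  proof -
    obtain u where u: "algebraic_int u" "1 - u \<in> A" "\<And>x. x \<in> F \<Longrightarrow> \<exists>k. u * x ^ k \<in> S"
      using ex_u[OF F] by blast
    have "u \<notin> S"
    proof
      assume "u \<in> S"
      then have "(1 - u) + u \<in> A" using SA u(2) by (intro ideal_add[OF A]) auto
      with proper show False by simp
    qed
    have "\<exists>v. algebraic_int v \<and> u * v \<notin> S \<and> (\<forall>x\<in>G. u * v * x \<in> S)" if "G \<subseteq> F" for G
      using finite_subset[OF that F(1)] that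
    proof (induction G)
      case empty
      show ?case using \<open>u \<notin> S\<close> by (intro exI[of _ 1]) auto
    next
      case (insert x G)
      then obtain v where v: "algebraic_int v" "u * v \<notin> S" "\<And>y. y \<in> G \<Longrightarrow> u * v * y \<in> S" by auto
      have x: "algebraic_int x" using insert.prems F ideal_algebraic_int[OF A] by auto
      obtain k where "u * x ^ k \<in> S" using u(3) insert.prems by blast
      then have "v * (u * x ^ k) \<in> S" using v(1) by (rule ideal_lmult[OF S])
      then have k: "u * v * x ^ k \<in> S" by (simp add: mult_ac)
      \<comment> \<open>the last power of \<open>x\<close> that does not kill \<open>u * v\<close> is \<open>x ^ (j - 1)\<close>\<close>
      define j where "j = (LEAST k. u * v * x ^ k \<in> S)"
      have j: "u * v * x ^ j \<in> S" unfolding j_def by (rule LeastI[of _ k]) (rule k)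
      with v(2) have "j \<noteq> 0" by (intro notI) simp
      then obtain i where i: "j = Suc i" using not0_implies_Suc by blast
      have "u * v * x ^ i \<notin> S"
        using not_less_Least[of i "\<lambda>k. u * v * x ^ k \<in> S"] i j_def by simp
      moreover have "u * v * x ^ i * x \<in> S" using j i by (simp add: mult_ac)
      moreover have "u * v * x ^ i * y \<in> S" if "y \<in> G" for y
        using ideal_lmult[OF S v(3)[OF that] algebraic_int_power[OF x, of i]]
        by (simp add: mult_ac)
      ultimately show ?case
        using v(1) x by (intro exI[of _ "v * x ^ i"])
          (auto intro: algebraic_int_mult algebraic_int_power simp: mult.assoc)
    qed
    then show ?thesis using u(1) algebraic_int_mult by blast
  qed
  obtain F where F: "finite F" "F \<subseteq> carrier OK" "\<And>x. algebraic_int x \<Longrightarrow> \<exists>f\<in>F. x - f \<in> S"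
    using fi unfolding finite_index_def by auto
  obtain w where w: "algebraic_int w" "w \<notin> S" "\<And>x. x \<in> F \<inter> A \<Longrightarrow> w * x \<in> S"
    using ex_w[of "F \<inter> A"] F(1) by auto
  have "w * x \<in> S" if x: "x \<in> A" for x
  proof -
    obtain f where f: "f \<in> F" "x - f \<in> S" using F(3) ideal_algebraic_int[OF A x] by blast
    have "x - f \<in> A" using SA f(2) by blast
    from ideal_diff[OF A x this] f(1) have "w * f \<in> S" by (intro w) auto
    moreover have "w * (x - f) \<in> S" using f(2) w(1) by (rule ideal_lmult[OF S])
    ultimately have "w * f + w * (x - f) \<in> S" by (rule ideal_add[OF S])
    then show ?thesis by (simp add: algebra_simps)
  qed
  with w that show ?thesis by blast
qed

lemma ideal_prod_OK_mult: "x \<in> I \<Longrightarrow> y \<in> J \<Longrightarrow> x * y \<in> ideal_prod OK I J"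
  using ideal_prod.prod[of x I y J OK] by simp

lemma ideal_prod_OK_subset:
  assumes "\<And>x y. x \<in> I \<Longrightarrow> y \<in> J \<Longrightarrow> x * y \<in> S"
    and "\<And>x y. x \<in> S \<Longrightarrow> y \<in> S \<Longrightarrow> x + y \<in> S"
  shows "ideal_prod OK I J \<subseteq> S"
proof
  fix x assume "x \<in> ideal_prod OK I J"
  then show "x \<in> S" by (induction rule: ideal_prod.induct) (use assms in auto)
qed

lemma ideal_ideal_prod: "ideal I OK \<Longrightarrow> ideal J OK \<Longrightarrow> ideal (ideal_prod OK I J) OK"
  by (rule OK.ideal_prod_is_ideal)

text \<open>For a nonzero $a \in J$ all $a c^k$ lie in $J$, hence in the ring of integers. By the
  pigeonhole principle two of them agree modulo $a$, so $c^j - c^i$ is an algebraic integer for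
  some $i < j$, and $c$ is a root of the monic polynomial $X^j - X^i$ minus this integer.\<close>

lemma algebraic_int_stable_ideal:
  fixes J :: "'k::field_char_0 set"
  assumes nf: "number_field TYPE('k)" and J: "nonzero_ideal J"
    and stable: "\<And>x. x \<in> J \<Longrightarrow> c * x \<in> J"
  shows "algebraic_int c"
proof -
  have J': "ideal J OK" using J by (simp add: nonzero_ideal_def)
  obtain a where a: "a \<in> J" "a \<noteq> 0"
    using J ideal_zero[OF J'] unfolding nonzero_ideal_def by blast
  have "a * c ^ k \<in> J" for k
  proof (induction k)
    case (Suc k)
    from stable[OF this] show ?case by (simp add: mult_ac)
  qed (use a in simp)
  then have int: "algebraic_int (a * c ^ k)" for k using ideal_algebraic_int[OF J'] by blast
  have aint: "algebraic_int a" using a ideal_algebraic_int[OF J'] by blast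
  have "nonzero_ideal (principal a)"
    using ideal_principal[OF aint] self_mem_principal[of a] a(2)
    by (auto simp: nonzero_ideal_def)
  then have fi: "finite_index (principal a)" by (rule finite_index_nonzero_ideal[OF nf])
  obtain i j where ij: "i < j" "a * c ^ j - a * c ^ i \<in> principal a"
    using finite_index_pigeonhole[OF fi ideal_principal[OF aint] int] .
  then obtain r where r: "algebraic_int r" "a * c ^ j - a * c ^ i = a * r"
    unfolding mem_principal by blast
  then have "a * (c ^ j - c ^ i) = a * r" by (simp add: right_diff_distrib)
  with a(2) have eq: "c ^ j - c ^ i = r" by simp
  define p :: "'k poly" where "p = monom 1 j - monom 1 i"
  have cj: "coeff p j = 1" using ij(1) by (simp add: p_def)
  have "degree p = j"
  proof (rule antisym)
    show "degree p \<le> j" unfolding p_def using ij(1)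
      by (intro degree_diff_le) (auto simp: degree_monom_eq)
    show "j \<le> degree p" using cj by (intro le_degree) simp
  qed
  show ?thesis
  proof (rule algebraic_int_root[OF r(1)])
    show "poly p c = r" using eq by (simp add: p_def poly_monom)
    show "\<forall>i. coeff p i \<in> \<int>" by (simp add: p_def)
    show "lead_coeff p = 1" "degree p > 0" using \<open>degree p = j\<close> cj ij(1) by auto
  qed
qed

text \<open>Take $J = \{b : bI \subseteq (a)\}$ for a nonzero $a \in I$ and $A = a^{-1} I J$. If
  $A$ were proper, there would be $w \notin (a)$ with $wA \subseteq (a)$. Then $w/a$ maps $J$ into
  itself, so it is an algebraic integer, which says $w \in (a)$.\<close>

lemma ideal_invertible:
  fixes I :: "'k::field_char_0 set"
  assumes nf: "number_field TYPE('k)" and I: "nonzero_ideal I"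
  obtains J a where "ideal J OK" "a \<noteq> 0" "ideal_prod OK I J = principal a"
proof -
  have I': "ideal I OK" using I by (simp add: nonzero_ideal_def)
  obtain a where a: "a \<in> I" "a \<noteq> 0"
    using I ideal_zero[OF I'] unfolding nonzero_ideal_def by blast
  have aint: "algebraic_int a" using a ideal_algebraic_int[OF I'] by blast
  have P: "ideal (principal a) OK" by (rule ideal_principal[OF aint])
  define J where "J = {b. algebraic_int b \<and> (\<forall>x\<in>I. b * x \<in> principal a)}"
  have J: "ideal J OK"
  proof (rule ideal_OK_I)
    show "0 \<in> J" using ideal_zero[OF P] by (simp add: J_def)
    show "b + c \<in> J" if "b \<in> J" "c \<in> J" for b c
      using that by (auto simp: J_def distrib_right intro: algebraic_int_add ideal_add[OF P])
    show "r * b \<in> J" if "algebraic_int r" "b \<in> J" for r b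
      using that by (auto simp: J_def mult.assoc intro: algebraic_int_mult ideal_lmult[OF P])
  qed (simp add: J_def)
  have aJ: "a \<in> J"
    using aint ideal_algebraic_int[OF I'] by (auto simp: J_def intro: mult_mem_principal)
  with a(2) J have nzJ: "nonzero_ideal J" by (auto simp: nonzero_ideal_def)
  let ?IJ = "ideal_prod OK I J"
  have IJ: "ideal ?IJ OK" by (rule ideal_ideal_prod[OF I' J])
  have sub: "?IJ \<subseteq> principal a"
    by (rule ideal_prod_OK_subset) (auto simp: J_def mult.commute intro: ideal_add[OF P])
  define A where "A = {x. algebraic_int x \<and> a * x \<in> ?IJ}"
  have A: "ideal A OK"
  proof (rule ideal_OK_I)
    show "0 \<in> A" using ideal_zero[OF IJ] by (simp add: A_def)
    show "b + c \<in> A" if "b \<in> A" "c \<in> A" for b c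
      using that by (auto simp: A_def distrib_left intro: algebraic_int_add ideal_add[OF IJ])
    show "r * b \<in> A" if "algebraic_int r" "b \<in> A" for r b
      using that
      by (auto simp: A_def mult.left_commute[of a r] intro: algebraic_int_mult ideal_lmult[OF IJ])
  qed (simp add: A_def)
  have JA: "J \<subseteq> A"
    using a(1) ideal_algebraic_int[OF J] by (auto simp: A_def intro: ideal_prod_OK_mult)
  have "1 \<in> A"
  proof (rule ccontr)
    assume proper: "1 \<notin> A"
    have "nonzero_ideal (principal a)"
      using P self_mem_principal[of a] a(2) by (auto simp: nonzero_ideal_def)
    then have fi: "finite_index (principal a)" by (rule finite_index_nonzero_ideal[OF nf])
    have "principal a \<subseteq> A" using principal_subset[OF A] JA aJ by blast
    then obtain w where w: "algebraic_int w" "w \<notin> principal a" "\<And>x. x \<in> A \<Longrightarrow> w * x \<in> principal a"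
      using proper_ideal_annihilator[OF fi P A _ proper] by blast
    have "algebraic_int (w / a)"
    proof (rule algebraic_int_stable_ideal[OF nf nzJ])
      fix b assume b: "b \<in> J"
      then obtain r where r: "algebraic_int r" "w * b = a * r"
        using w(3) JA unfolding mem_principal by blast
      then have wb: "w / a * b = r" using a(2) by (simp add: field_simps)
      have "r * x \<in> principal a" if x: "x \<in> I" for x
      proof -
        have "b * x \<in> principal a" using b x by (simp add: J_def)
        then obtain s where s: "algebraic_int s" "b * x = a * s" unfolding mem_principal by blast
        have "a * s \<in> ?IJ" using ideal_prod_OK_mult[OF x b] s(2) by (simp add: mult.commute)
        with s(1) have "s \<in> A" by (simp add: A_def)
        moreover have "r * x = w * s"
        proof -
          have "a * (r * x) = w * (b * x)" using r(2) by (simp flip: mult.assoc)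
          also have "\<dots> = a * (w * s)" unfolding s(2) by (rule mult.left_commute)
          finally show ?thesis using a(2) by simp
        qed
        ultimately show ?thesis using w(3) by simp
      qed
      with r(1) show "w / a * b \<in> J" unfolding wb by (simp add: J_def)
    qed
    then have "a * (w / a) \<in> principal a" by (rule mult_mem_principal)
    with a(2) w(2) show False by simp
  qed
  then have "principal a \<subseteq> ?IJ" using principal_subset[OF IJ] by (simp add: A_def)
  with sub have "?IJ = principal a" by blast
  with J a(2) that show ?thesis by blast
qed

section \<open>Coprimality and divisibility of ideals\<close>

lemma ideal_prod_subset_left: "ideal I OK \<Longrightarrow> ideal J OK \<Longrightarrow> ideal_prod OK I J \<subseteq> I"
  and ideal_prod_subset_right: "ideal I OK \<Longrightarrow> ideal J OK \<Longrightarrow> ideal_prod OK I J \<subseteq> J"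
  using OK.ideal_prod_inter[of I J] by auto

lemma nonzero_ideal_prod: "nonzero_ideal I \<Longrightarrow> nonzero_ideal J \<Longrightarrow> nonzero_ideal (ideal_prod OK I J)"
  unfolding nonzero_ideal_iff
  by (metis ideal_ideal_prod ideal_prod_OK_mult mult_eq_0_iff)

lemma nonzero_ideal_prod_right:
  assumes "ideal I OK" "ideal J OK" "nonzero_ideal (ideal_prod OK I J)"
  shows "nonzero_ideal J"
  using assms nonzero_ideal_mono ideal_prod_subset_right by blast

lemma set_add_OK_commute: "I <+>\<^bsub>OK\<^esub> J = J <+>\<^bsub>OK\<^esub> I"
proof -
  have "I <+>\<^bsub>OK\<^esub> J \<subseteq> J <+>\<^bsub>OK\<^esub> I" for I J :: "'a set"
  proof
    fix z assume "z \<in> I <+>\<^bsub>OK\<^esub> J"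
    then obtain x y where "x \<in> I" "y \<in> J" "z = x + y" unfolding set_add_OK by blast
    then show "z \<in> J <+>\<^bsub>OK\<^esub> I"
      unfolding set_add_OK using add.commute[of x y] by blast
  qed
  then show ?thesis by blast
qed

lemma finite_common_subideal:
  assumes "finite X" "\<And>I. I \<in> X \<Longrightarrow> nonzero_ideal I"
  obtains s where "nonzero_ideal s" "\<And>I. I \<in> X \<Longrightarrow> s \<subseteq> I"
proof -
  have "\<exists>s. nonzero_ideal s \<and> (\<forall>I\<in>X. s \<subseteq> I)"
    using assms
  proof (induction X)
    case empty
    show ?case using nonzero_ideal_carrier by blast
  next
    case (insert I X)
    then obtain s where s: "nonzero_ideal s" "\<forall>I\<in>X. s \<subseteq> I" by auto
    have I: "nonzero_ideal I" using insert.prems by blast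
    show ?case
      using s I nonzero_ideal_prod[OF s(1) I] ideal_prod_subset_left[of s I]
        ideal_prod_subset_right[of s I]
      by (intro exI[of _ "ideal_prod OK s I"]) (auto dest!: nonzero_idealD)
  qed
  with that show ?thesis by blast
qed

lemma coprime_mono:
  assumes "ideal c OK" "ideal s OK" "ideal t OK" "s \<subseteq> t" "c <+>\<^bsub>OK\<^esub> s = carrier OK"
  shows "c <+>\<^bsub>OK\<^esub> t = carrier OK"
  using assms(4,5) unfolding set_add_eq_carrier_iff[OF assms(1,2)]
    set_add_eq_carrier_iff[OF assms(1,3)] by blast

lemma coprime_ideal_prod:
  assumes I: "ideal b OK" "ideal c OK" "ideal s OK"
    and "b <+>\<^bsub>OK\<^esub> s = carrier OK" "c <+>\<^bsub>OK\<^esub> s = carrier OK"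
  shows "ideal_prod OK b c <+>\<^bsub>OK\<^esub> s = carrier OK"
proof -
  obtain x y where xy: "x \<in> b" "y \<in> s" "x + y = 1"
    using assms(4) unfolding set_add_eq_carrier_iff[OF I(1,3)] by blast
  obtain u v where uv: "u \<in> c" "v \<in> s" "u + v = 1"
    using assms(5) unfolding set_add_eq_carrier_iff[OF I(2,3)] by blast
  have "x * v + y \<in> s"
    using xy uv I by (auto intro!: ideal_add ideal_lmult dest: ideal_algebraic_int)
  moreover have "x * u + (x * v + y) = 1"
    using xy(3) uv(3) by (simp flip: add.assoc distrib_left)
  moreover have "x * u \<in> ideal_prod OK b c" using xy(1) uv(1) by (rule ideal_prod_OK_mult)
  ultimately show ?thesis
    unfolding set_add_eq_carrier_iff[OF ideal_ideal_prod[OF I(1,2)] I(3)] by blast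
qed

text \<open>For an ideal $J$ with $dJ = (a)$, multiplying $d \subseteq dc$ by $J$ gives $(a)
  \subseteq ac$.\<close>

lemma ideal_prod_cancel:
  fixes d :: "'k::field_char_0 set"
  assumes nf: "number_field TYPE('k)" and d: "nonzero_ideal d" and c: "ideal c OK"
    and sub: "d \<subseteq> ideal_prod OK d c"
  shows "1 \<in> c"
proof -
  obtain J a where J: "ideal J OK" "a \<noteq> 0" "ideal_prod OK d J = principal a"
    using ideal_invertible[OF nf d] .
  have "ideal_prod OK d J \<subseteq> (\<lambda>x. a * x) ` c"
  proof (rule ideal_prod_OK_subset)
    fix x j assume x: "x \<in> d" and j: "j \<in> J"
    have "ideal_prod OK d c \<subseteq> {x. x * j \<in> (\<lambda>x. a * x) ` c}"
    proof (rule ideal_prod_OK_subset)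
      fix y z assume y: "y \<in> d" and z: "z \<in> c"
      have "y * j \<in> principal a" using ideal_prod_OK_mult[OF y j] J(3) by simp
      then obtain r where "algebraic_int r" "y * j = a * r" unfolding mem_principal by blast
      moreover from this have "y * z * j = a * (r * z)" by (metis mult.assoc mult.commute)
      ultimately show "y * z \<in> {x. x * j \<in> (\<lambda>x. a * x) ` c}"
        using ideal_lmult[OF c z, of r] by blast
    next
      fix y z assume "y \<in> {x. x * j \<in> (\<lambda>x. a * x) ` c}" "z \<in> {x. x * j \<in> (\<lambda>x. a * x) ` c}"
      then obtain p q where pq: "p \<in> c" "q \<in> c" "y * j = a * p" "z * j = a * q" by blast
      then have "(y + z) * j = a * (p + q)" by (simp add: distrib_left distrib_right)
      with ideal_add[OF c pq(1,2)] show "y + z \<in> {x. x * j \<in> (\<lambda>x. a * x) ` c}" by blast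
    qed
    with x sub show "x * j \<in> (\<lambda>x. a * x) ` c" by blast
  next
    fix x y assume "x \<in> (\<lambda>x. a * x) ` c" "y \<in> (\<lambda>x. a * x) ` c"
    then obtain p q where pq: "p \<in> c" "q \<in> c" "x = a * p" "y = a * q" by blast
    then have "x + y = a * (p + q)" by (simp add: distrib_left)
    with ideal_add[OF c pq(1,2)] show "x + y \<in> (\<lambda>x. a * x) ` c" by blast
  qed
  then obtain x where "x \<in> c" "a = a * x" using J(3) self_mem_principal by blast
  with J(2) show ?thesis by simp
qed

text \<open>The ideals are $d = b + gs$ and the quotient $c = (b : d)$. Invertibility of $d$, in
  the form $dJ = (a)$, gives $b = dc$. Writing $a$ as a sum of products $xj$ with $x = y + gu$, $y
  \in b$, $u \in s$, both $yj \in ac$ and $guj \in as$, so dividing by $a$ gives $1 \in c + s$.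
  Finally, $c$ is proper because $g$ is in $d$ but not in $b$.\<close>

lemma ideal_factor_coprime:
  fixes b s :: "'k::field_char_0 set"
  assumes nf: "number_field TYPE('k)" and b: "nonzero_ideal b" and s: "ideal s OK"
    and g: "algebraic_int g" "g \<notin> b" and t: "t \<in> s" "g + g * t \<in> b"
  obtains d c where "nonzero_ideal d" "g \<in> d" "ideal c OK" "1 \<notin> c"
    "c <+>\<^bsub>OK\<^esub> s = carrier OK" "ideal_prod OK d c = b"
proof -
  have b': "ideal b OK" using b by (rule nonzero_idealD)
  define gs where "gs = (\<lambda>x. g * x) ` s"
  have gs: "ideal gs OK"
  proof (rule ideal_OK_I)
    show "algebraic_int x" if "x \<in> gs" for x
      using that g(1) ideal_algebraic_int[OF s] by (auto simp: gs_def intro: algebraic_int_mult)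
    show "0 \<in> gs" using ideal_zero[OF s] by (force simp: gs_def)
    show "x + y \<in> gs" if "x \<in> gs" "y \<in> gs" for x y
      using that ideal_add[OF s] unfolding gs_def by (auto simp flip: distrib_left)
    show "r * x \<in> gs" if "algebraic_int r" "x \<in> gs" for r x
      using that ideal_lmult[OF s] unfolding gs_def by (auto simp: mult.left_commute[of r])
  qed
  define d where "d = b <+>\<^bsub>OK\<^esub> gs"
  have d: "ideal d OK" unfolding d_def by (rule ideal_set_add[OF b' gs])
  have bd: "b \<subseteq> d" using ideal_zero[OF gs] unfolding d_def set_add_OK by force
  have nzd: "nonzero_ideal d" using b bd d by (rule nonzero_ideal_mono)
  have gd: "g \<in> d"
  proof -
    have "- (g * t) \<in> gs" using t(1) by (intro ideal_minus[OF gs]) (auto simp: gs_def)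
    moreover have "g = (g + g * t) + - (g * t)" by simp
    ultimately show ?thesis using t(2) unfolding d_def set_add_OK by blast
  qed
  define c where "c = {x. algebraic_int x \<and> (\<forall>y\<in>d. x * y \<in> b)}"
  have c: "ideal c OK"
  proof (rule ideal_OK_I)
    show "0 \<in> c" using ideal_zero[OF b'] by (simp add: c_def)
    show "x + y \<in> c" if "x \<in> c" "y \<in> c" for x y
      using that by (auto simp: c_def distrib_right intro: algebraic_int_add ideal_add[OF b'])
    show "r * x \<in> c" if "algebraic_int r" "x \<in> c" for r x
      using that by (auto simp: c_def mult.assoc intro: algebraic_int_mult ideal_lmult[OF b'])
  qed (simp add: c_def)
  obtain J a where J: "ideal J OK" "a \<noteq> 0" "ideal_prod OK d J = principal a"
    using ideal_invertible[OF nf nzd] .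
  have quot: "\<exists>r. algebraic_int r \<and> y * j = a * r" if "y \<in> d" "j \<in> J" for y j
    using ideal_prod_OK_mult[OF that] J(3) unfolding mem_principal[symmetric] by simp
  have quot_b: "\<exists>r\<in>c. y * j = a * r" if y: "y \<in> b" and j: "j \<in> J" for y j
  proof -
    obtain r where r: "algebraic_int r" "y * j = a * r" using quot y j bd by blast
    have "r * z \<in> b" if z: "z \<in> d" for z
    proof -
      obtain q where q: "algebraic_int q" "z * j = a * q" using quot[OF z j] by blast
      have "a * (r * z) = (y * j) * z" unfolding r(2) by (rule mult.assoc[symmetric])
      also have "\<dots> = (z * j) * y" by (simp only: ac_simps)
      also have "\<dots> = a * (q * y)" unfolding q(2) by (rule mult.assoc)
      finally have "a * (r * z) = a * (q * y)" .
      then have "r * z = q * y" using J(2) by simp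
      then show ?thesis using ideal_lmult[OF b' y q(1)] by simp
    qed
    with r show ?thesis by (auto simp: c_def)
  qed
  have "ideal_prod OK d c = b"
  proof (rule equalityI)
    show "ideal_prod OK d c \<subseteq> b"
      by (rule ideal_prod_OK_subset) (auto simp: c_def mult.commute intro: ideal_add[OF b'])
    show "b \<subseteq> ideal_prod OK d c"
    proof
      fix y assume y: "y \<in> b"
      have dc: "ideal (ideal_prod OK d c) OK" by (rule ideal_ideal_prod[OF d c])
      have "ideal_prod OK d J \<subseteq> {x. \<exists>z\<in>ideal_prod OK d c. y * x = a * z}"
      proof (rule ideal_prod_OK_subset)
        fix x j assume x: "x \<in> d" and j: "j \<in> J"
        obtain r where r: "r \<in> c" "y * j = a * r" using quot_b[OF y j] by blast
        have "y * (x * j) = x * (y * j)" by (rule mult.left_commute)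
      also have "\<dots> = a * (x * r)" unfolding r(2) by (rule mult.left_commute)
      finally have "y * (x * j) = a * (x * r)" .
        with ideal_prod_OK_mult[OF x r(1)] show "x * j \<in> {x. \<exists>z\<in>ideal_prod OK d c. y * x = a * z}"
          by blast
      next
        fix u v assume "u \<in> {x. \<exists>z\<in>ideal_prod OK d c. y * x = a * z}"
          "v \<in> {x. \<exists>z\<in>ideal_prod OK d c. y * x = a * z}"
        then obtain p q where pq: "p \<in> ideal_prod OK d c" "q \<in> ideal_prod OK d c"
          "y * u = a * p" "y * v = a * q" by blast
        then have "y * (u + v) = a * (p + q)" by (simp add: distrib_left)
        with ideal_add[OF dc pq(1,2)]
        show "u + v \<in> {x. \<exists>z\<in>ideal_prod OK d c. y * x = a * z}" by blast
      qed
      then obtain z where "z \<in> ideal_prod OK d c" "y * a = a * z"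
        using J(3) self_mem_principal by blast
      with J(2) show "y \<in> ideal_prod OK d c" by (simp add: mult.commute)
    qed
  qed
  moreover have "c <+>\<^bsub>OK\<^esub> s = carrier OK"
  proof -
    have cs: "ideal (c <+>\<^bsub>OK\<^esub> s) OK" by (rule ideal_set_add[OF c s])
    have "ideal_prod OK d J \<subseteq> (\<lambda>x. a * x) ` (c <+>\<^bsub>OK\<^esub> s)"
    proof (rule ideal_prod_OK_subset)
      fix x j assume x: "x \<in> d" and j: "j \<in> J"
      obtain y u where yu: "y \<in> b" "u \<in> s" "x = y + g * u"
        using x unfolding d_def set_add_OK gs_def by blast
      obtain r where r: "r \<in> c" "y * j = a * r" using quot_b[OF yu(1) j] by blast
      obtain q where q: "algebraic_int q" "g * j = a * q" using quot[OF gd j] by blast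
      have "x * j = y * j + (g * j) * u" unfolding yu(3) by (simp add: algebra_simps)
      also have "\<dots> = a * (r + q * u)" unfolding r(2) q(2) by (simp add: algebra_simps)
      finally have "x * j = a * (r + q * u)" .
      moreover have "r + q * u \<in> c <+>\<^bsub>OK\<^esub> s"
        unfolding set_add_OK using r(1) ideal_lmult[OF s yu(2) q(1)] by blast
      ultimately show "x * j \<in> (\<lambda>x. a * x) ` (c <+>\<^bsub>OK\<^esub> s)" by blast
    next
      fix x y assume "x \<in> (\<lambda>x. a * x) ` (c <+>\<^bsub>OK\<^esub> s)" "y \<in> (\<lambda>x. a * x) ` (c <+>\<^bsub>OK\<^esub> s)"
      then obtain p q where pq: "p \<in> c <+>\<^bsub>OK\<^esub> s" "q \<in> c <+>\<^bsub>OK\<^esub> s" "x = a * p" "y = a * q"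
        by blast
      then have "x + y = a * (p + q)" by (simp add: distrib_left)
      with ideal_add[OF cs pq(1,2)] show "x + y \<in> (\<lambda>x. a * x) ` (c <+>\<^bsub>OK\<^esub> s)" by blast
    qed
    then obtain x where "x \<in> c <+>\<^bsub>OK\<^esub> s" "a = a * x" using J(3) self_mem_principal by blast
    with J(2) have "1 \<in> c <+>\<^bsub>OK\<^esub> s" by simp
    then show ?thesis using ideal_eq_carrier_iff[OF cs] by blast
  qed
  moreover have "1 \<notin> c" using gd g(2) by (auto simp: c_def)
  ultimately show ?thesis using that nzd gd c by blast
qed

text \<open>For members $c$ that are not coprime to $s$, the proper ideals $c + s$ are pairwise
  distinct, because a common value would contain $c + c' = R$. Only finitely many ideals lie above
  $s$, so all but finitely many members are coprime to $s$.\<close>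

lemma infinite_coprime_avoids:
  fixes C :: "'k::field_char_0 set set"
  assumes nf: "number_field TYPE('k)" and C: "infinite C" "\<forall>c\<in>C. ideal c OK" "pairwise_coprime C"
    and s: "nonzero_ideal s"
  obtains c where "c \<in> C" "1 \<notin> c" "c <+>\<^bsub>OK\<^esub> s = carrier OK"
proof -
  have s': "ideal s OK" by (rule nonzero_idealD[OF s])
  define T where "T = {c \<in> C. c <+>\<^bsub>OK\<^esub> s \<noteq> carrier OK}"
  have sub: "c \<subseteq> c <+>\<^bsub>OK\<^esub> s" for c
    unfolding set_add_OK using ideal_zero[OF s'] by force
  have "inj_on (\<lambda>c. c <+>\<^bsub>OK\<^esub> s) T"
  proof (rule inj_onI, rule ccontr)
    fix c c' assume T: "c \<in> T" "c' \<in> T" and eq: "c <+>\<^bsub>OK\<^esub> s = c' <+>\<^bsub>OK\<^esub> s" and ne: "c \<noteq> c'"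
    have I: "ideal c OK" "ideal c' OK" using C(2) T by (auto simp: T_def)
    have cs: "ideal (c <+>\<^bsub>OK\<^esub> s) OK" by (rule ideal_set_add[OF I(1) s'])
    have "c <+>\<^bsub>OK\<^esub> c' = carrier OK"
      using C(3) T ne unfolding pairwise_coprime_def pairwise_def by (auto simp: T_def)
    then obtain x y where xy: "x \<in> c" "y \<in> c'" "x + y = 1"
      unfolding set_add_eq_carrier_iff[OF I] by blast
    have "x \<in> c <+>\<^bsub>OK\<^esub> s" "y \<in> c <+>\<^bsub>OK\<^esub> s" using xy sub eq by blast+
    from ideal_add[OF cs this] xy(3) have "c <+>\<^bsub>OK\<^esub> s = carrier OK"
      using ideal_eq_carrier_iff[OF cs] by simp
    with T(1) show False by (simp add: T_def)
  qed
  moreover have "(\<lambda>c. c <+>\<^bsub>OK\<^esub> s) ` T \<subseteq> {I. ideal I OK \<and> s \<subseteq> I}"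
  proof
    fix I assume "I \<in> (\<lambda>c. c <+>\<^bsub>OK\<^esub> s) ` T"
    then obtain c where c: "ideal c OK" "I = c <+>\<^bsub>OK\<^esub> s" using C(2) by (auto simp: T_def)
    have "s \<subseteq> c <+>\<^bsub>OK\<^esub> s" unfolding set_add_OK using ideal_zero[OF c(1)] by force
    with c ideal_set_add[OF c(1) s'] show "I \<in> {I. ideal I OK \<and> s \<subseteq> I}" by simp
  qed
  ultimately have "finite T"
    using finite_ideals_above[OF finite_index_nonzero_ideal[OF nf s]]
    by (meson finite_subset finite_imageD)
  then have "finite (insert (carrier OK) T)" by simp
  then obtain c where c: "c \<in> C" "c \<notin> insert (carrier OK) T"
    using C(1) by (meson finite_subset subsetI)
  then have "ideal c OK" using C(2) by blast
  with c that show ?thesis using ideal_eq_carrier_iff[of c] by (auto simp: T_def)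
qed

section \<open>The enlarged collection\<close>

text \<open>Quantifying over all moduli $s$ replaces the infinite coprime collection: choosing
  $c_n$ coprime to $s_n = c_0 \cdots c_{n-1}$ produces one, since $s_n \subseteq c_m$ for $m <
  n$.\<close>

lemma D_ideals_iff:
  fixes A :: "'k::field_char_0 set set"
  assumes nf: "number_field TYPE('k)" and A: "\<forall>b\<in>A. nonzero_ideal b"
  shows "d \<in> D_ideals A \<longleftrightarrow> nonzero_ideal d \<and>
    (\<forall>s. nonzero_ideal s \<longrightarrow>
       (\<exists>c. ideal c OK \<and> 1 \<notin> c \<and> c <+>\<^bsub>OK\<^esub> s = carrier OK \<and> ideal_prod OK d c \<in> A))"
    (is "?L \<longleftrightarrow> ?R")
proof
  assume ?L
  then obtain C where C: "nonzero_ideal d" "infinite C" "\<forall>c\<in>C. ideal c OK"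
    "pairwise_coprime C" "ideal_prod OK d ` C \<subseteq> A"
    unfolding D_ideals_def by blast
  show ?R
  proof (intro conjI allI impI)
    fix s :: "'k set" assume "nonzero_ideal s"
    from infinite_coprime_avoids[OF nf C(2-4) this]
    obtain c where "c \<in> C" "1 \<notin> c" "c <+>\<^bsub>OK\<^esub> s = carrier OK" .
    with C show "\<exists>c. ideal c OK \<and> 1 \<notin> c \<and> c <+>\<^bsub>OK\<^esub> s = carrier OK \<and> ideal_prod OK d c \<in> A"
      by blast
  qed (rule C)
next
  assume R: ?R
  then have d: "nonzero_ideal d" by blast
  obtain f where f: "\<And>s. nonzero_ideal s \<Longrightarrow> ideal (f s) OK \<and> 1 \<notin> f s \<and>
      f s <+>\<^bsub>OK\<^esub> s = carrier OK \<and> ideal_prod OK d (f s) \<in> A"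
  proof -
    have "\<forall>s. \<exists>c. nonzero_ideal s \<longrightarrow> ideal c OK \<and> 1 \<notin> c \<and>
        c <+>\<^bsub>OK\<^esub> s = carrier OK \<and> ideal_prod OK d c \<in> A"
      using R by blast
    from choice[OF this] show ?thesis using that by blast
  qed
  define S where "S = rec_nat (carrier OK) (\<lambda>_ s. ideal_prod OK s (f s))"
  have S_simps: "S 0 = carrier OK" "S (Suc n) = ideal_prod OK (S n) (f (S n))" for n
    by (simp_all add: S_def)
  have f_nz: "nonzero_ideal (f s)" if "nonzero_ideal s" for s
    using f[OF that] A d nonzero_ideal_prod_right nonzero_idealD by blast
  have S_nz: "nonzero_ideal (S n)" for n
    by (induction n) (simp_all only: S_simps f_nz nonzero_ideal_prod nonzero_ideal_carrier)
  define c where "c n = f (S n)" for n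
  have c: "ideal (c n) OK" "1 \<notin> c n" "c n <+>\<^bsub>OK\<^esub> S n = carrier OK" "ideal_prod OK d (c n) \<in> A"
    for n using f[OF S_nz] by (auto simp: c_def)
  have S_id: "ideal (S n) OK" for n by (rule nonzero_idealD[OF S_nz])
  have "S (Suc n) \<subseteq> S n" for n
    unfolding S_simps c_def[symmetric] by (rule ideal_prod_subset_left[OF S_id c(1)])
  then have S_anti: "S n \<subseteq> S m" if "m \<le> n" for m n
    using that by (rule lift_Suc_antimono_le)
  have coprime: "c n <+>\<^bsub>OK\<^esub> c m = carrier OK" if "m < n" for m n
  proof (rule coprime_mono[OF c(1) S_id c(1) _ c(3)])
    have "S n \<subseteq> S (Suc m)" using that by (intro S_anti) simp
    also have "\<dots> \<subseteq> c m"
      unfolding S_simps c_def[symmetric] by (rule ideal_prod_subset_right[OF S_id c(1)])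
    finally show "S n \<subseteq> c m" .
  qed
  have comm: "c n <+>\<^bsub>OK\<^esub> c m = c m <+>\<^bsub>OK\<^esub> c n" for m n
    by (rule set_add_OK_commute)
  have "c m \<noteq> c n" if "m < n" for m n
  proof
    assume "c m = c n"
    with coprime[OF that] have "c n <+>\<^bsub>OK\<^esub> c n = carrier OK" by simp
    then obtain x y where "x \<in> c n" "y \<in> c n" "x + y = 1"
      unfolding set_add_eq_carrier_iff[OF c(1) c(1)] by blast
    then show False using c(2)[of n] ideal_add[OF c(1)] by metis
  qed
  then have "inj c" by (rule linorder_injI)
  then have "infinite (range c)" by (rule range_inj_infinite)
  moreover have "pairwise_coprime (range c)"
    unfolding pairwise_coprime_def
  proof (rule pairwiseI)
    fix x y assume "x \<in> range c" "y \<in> range c" "x \<noteq> y"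
    then obtain m n where mn: "x = c m" "y = c n" "m \<noteq> n" by blast
    then consider "m < n" | "n < m" by linarith
    then show "x <+>\<^bsub>OK\<^esub> y = carrier OK"
      using coprime[of m n] coprime[of n m] comm[of m n] unfolding mn by cases metis+
  qed
  ultimately show ?L
    unfolding D_ideals_def using d c by (auto intro!: exI[of _ "range c"])
qed

lemma nonzero_ideal_D_ideals: "d \<in> D_ideals A \<Longrightarrow> nonzero_ideal d"
  by (simp add: D_ideals_def)

text \<open>Only finitely many ideals contain a given nonzero one, so maximal elements above it
  exist.\<close>

lemma ex_star_above:
  fixes B :: "'k::field_char_0 set set"
  assumes nf: "number_field TYPE('k)" and B: "\<forall>b\<in>B. nonzero_ideal b"
    and d: "d \<in> B \<union> D_ideals B"
  obtains m where "m \<in> star B" "d \<subseteq> m"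
proof -
  have nz: "nonzero_ideal b" if "b \<in> B \<union> D_ideals B" for b
    using that B nonzero_ideal_D_ideals by blast
  define U where "U = {u \<in> B \<union> D_ideals B. d \<subseteq> u}"
  have "U \<subseteq> {I. ideal I OK \<and> d \<subseteq> I}" unfolding U_def using nz nonzero_idealD by blast
  then have "finite U"
    using finite_ideals_above[OF finite_index_nonzero_ideal[OF nf nz[OF d]]] finite_subset by blast
  moreover have "d \<in> U" using d by (simp add: U_def)
  ultimately obtain m where m: "m \<in> U" "\<And>b. b \<in> U \<Longrightarrow> m \<subseteq> b \<Longrightarrow> m = b"
    using finite_has_maximal[of U] by blast
  then have "m \<in> star B" unfolding star_def prim_def U_def by blast
  moreover have "d \<subseteq> m" using m(1) by (simp add: U_def)
  ultimately show ?thesis using that by blast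
qed

lemma multiples_star:
  fixes B :: "'k::field_char_0 set set"
  assumes nf: "number_field TYPE('k)" and B: "\<forall>b\<in>B. nonzero_ideal b"
  shows "multiples (star B) = \<Union> (B \<union> D_ideals B)"
proof
  show "multiples (star B) \<subseteq> \<Union> (B \<union> D_ideals B)"
    by (auto simp: multiples_def star_def prim_def)
  show "\<Union> (B \<union> D_ideals B) \<subseteq> multiples (star B)"
  proof
    fix x assume "x \<in> \<Union> (B \<union> D_ideals B)"
    then obtain d where d: "d \<in> B \<union> D_ideals B" "x \<in> d" by blast
    obtain m where "m \<in> star B" "d \<subseteq> m" using ex_star_above[OF nf B d(1)] .
    with d(2) show "x \<in> multiples (star B)" unfolding multiples_def by blast
  qed
qed

text \<open>If $d$ were such an ideal, each product $dc$ in $B^*$ would be in $B$ or in $D(B)$,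
  and in the second case a further factor $e$, coprime to the same modulus, would put $dce$ into
  $B$. Thus $d$ would be in $D(B)$; but $d$ properly contains $dc$, which is maximal in $B \cup
  D(B)$.\<close>

lemma D_ideals_star:
  fixes B :: "'k::field_char_0 set set"
  assumes nf: "number_field TYPE('k)" and B: "\<forall>b\<in>B. nonzero_ideal b"
  shows "D_ideals (star B) = {}"
proof (rule equals0I)
  fix d assume "d \<in> D_ideals (star B)"
  have star: "\<forall>b\<in>star B. nonzero_ideal b"
    using B nonzero_ideal_D_ideals by (auto simp: star_def prim_def)
  have d: "nonzero_ideal d" using \<open>d \<in> D_ideals (star B)\<close> by (rule nonzero_ideal_D_ideals)
  note d' = nonzero_idealD[OF d]
  have ex: "\<exists>c. ideal c OK \<and> 1 \<notin> c \<and> c <+>\<^bsub>OK\<^esub> s = carrier OK \<and> ideal_prod OK d c \<in> star B"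
    if "nonzero_ideal s" for s
    using \<open>d \<in> D_ideals (star B)\<close> that unfolding D_ideals_iff[OF nf star] by blast
  have "\<exists>c. ideal c OK \<and> 1 \<notin> c \<and> c <+>\<^bsub>OK\<^esub> s = carrier OK \<and> ideal_prod OK d c \<in> B"
    if s: "nonzero_ideal s" for s
  proof -
    note s' = nonzero_idealD[OF s]
    obtain c where c: "ideal c OK" "1 \<notin> c" "c <+>\<^bsub>OK\<^esub> s = carrier OK" "ideal_prod OK d c \<in> star B"
      using ex[OF s] by blast
    show ?thesis
    proof (cases "ideal_prod OK d c \<in> B")
      case False
      with c(4) have "ideal_prod OK d c \<in> D_ideals B" by (auto simp: star_def prim_def)
      then obtain e where e: "ideal e OK" "1 \<notin> e" "e <+>\<^bsub>OK\<^esub> s = carrier OK"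
        "ideal_prod OK (ideal_prod OK d c) e \<in> B"
        using s unfolding D_ideals_iff[OF nf B] by blast
      have "ideal_prod OK (ideal_prod OK d c) e = ideal_prod OK d (ideal_prod OK c e)"
        by (intro OK.ideal_prod_assoc d' c e)
      moreover have "1 \<notin> ideal_prod OK c e"
        using c(2) ideal_prod_subset_left[OF c(1) e(1)] by blast
      ultimately show ?thesis
        using e(4) ideal_ideal_prod[OF c(1) e(1)] coprime_ideal_prod[OF c(1) e(1) s' c(3) e(3)]
        by metis
    qed (use c in blast)
  qed
  with d have dD: "d \<in> D_ideals B" unfolding D_ideals_iff[OF nf B] by blast
  obtain c where c: "ideal c OK" "1 \<notin> c" "ideal_prod OK d c \<in> star B"
    using ex[OF nonzero_ideal_carrier] by blast
  have "ideal_prod OK d c \<subseteq> d" by (rule ideal_prod_subset_left[OF d' c(1)])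
  moreover have "\<not> d \<subseteq> ideal_prod OK d c" using ideal_prod_cancel[OF nf d c(1)] c(2) by blast
  ultimately show False using c(3) dD by (auto simp: star_def prim_def)
qed

section \<open>Patterns of the two arrays\<close>

text \<open>For each of the finitely many ideals $d$ containing $g$, some modulus shows that $d$
  is not in $D(A)$. Let $s$ lie in all these moduli. If $g + gu$ with $u \in s$ were in some $b
  \in A$, the factorization of $b$ above would contradict the modulus belonging to its factor
  $d$.\<close>

lemma free_coset_if_no_D_ideals:
  fixes A :: "'k::field_char_0 set set"
  assumes nf: "number_field TYPE('k)" and A: "\<forall>b\<in>A. nonzero_ideal b"
    and D: "D_ideals A = {}" and g: "g \<in> free_set A"
  obtains s where "nonzero_ideal s" "\<And>t. t \<in> s \<Longrightarrow> g + t \<in> free_set A"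
proof (cases "A = {}")
  case True
  show ?thesis
    using g True by (intro that[OF nonzero_ideal_carrier])
      (auto simp: free_set_def multiples_def intro: algebraic_int_add)
next
  case False
  have gint: "algebraic_int g" and gA: "\<And>b. b \<in> A \<Longrightarrow> g \<notin> b"
    using g by (auto simp: free_set_def multiples_def)
  have g0: "g \<noteq> 0" using False gA A ideal_zero nonzero_idealD by blast
  define X where "X = {d. ideal d OK \<and> principal g \<subseteq> d}"
  have "finite X" unfolding X_def
    by (rule finite_ideals_above[OF finite_index_nonzero_ideal[OF nf nonzero_ideal_principal[OF gint g0]]])
  have "\<exists>s. nonzero_ideal s \<and> (\<forall>c. ideal c OK \<longrightarrow> 1 \<notin> c \<longrightarrow> c <+>\<^bsub>OK\<^esub> s = carrier OK \<longrightarrow> ideal_prod OK d c \<notin> A)"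
    if d: "d \<in> X" for d
  proof -
    have "nonzero_ideal d"
      using d nonzero_ideal_mono[OF nonzero_ideal_principal[OF gint g0]] by (auto simp: X_def)
    with D show ?thesis using D_ideals_iff[OF nf A, where d = d] by blast
  qed
  then obtain f where f: "\<And>d. d \<in> X \<Longrightarrow> nonzero_ideal (f d)"
    "\<And>d c. d \<in> X \<Longrightarrow> ideal c OK \<Longrightarrow> 1 \<notin> c \<Longrightarrow> c <+>\<^bsub>OK\<^esub> f d = carrier OK \<Longrightarrow> ideal_prod OK d c \<notin> A"
    by metis
  obtain s where s: "nonzero_ideal s" "\<And>d. d \<in> X \<Longrightarrow> s \<subseteq> f d"
    using finite_common_subideal[of "f ` X"] \<open>finite X\<close> f(1) by (metis finite_imageI imageE imageI)
  note s' = nonzero_idealD[OF s(1)]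
  let ?gs = "ideal_prod OK (principal g) s"
  have gs: "nonzero_ideal ?gs" by (rule nonzero_ideal_prod[OF nonzero_ideal_principal[OF gint g0] s(1)])
  have gs_sub: "?gs \<subseteq> (\<lambda>x. g * x) ` s"
  proof (rule ideal_prod_OK_subset)
    fix x y assume "x \<in> principal g" "y \<in> s"
    then show "x * y \<in> (\<lambda>x. g * x) ` s"
      unfolding mem_principal by (auto simp: mult.assoc intro: ideal_lmult[OF s'])
  next
    fix x y assume "x \<in> (\<lambda>x. g * x) ` s" "y \<in> (\<lambda>x. g * x) ` s"
    then obtain u v where uv: "u \<in> s" "v \<in> s" "x = g * u" "y = g * v" by blast
    then have "x + y = g * (u + v)" by (simp add: distrib_left)
    with ideal_add[OF s' uv(1,2)] show "x + y \<in> (\<lambda>x. g * x) ` s" by blast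
  qed
  show ?thesis
  proof (rule that[OF gs])
    fix t assume t: "t \<in> ?gs"
    show "g + t \<in> free_set A"
    proof (rule ccontr)
      assume "g + t \<notin> free_set A"
      moreover have "algebraic_int (g + t)"
        using gint t ideal_algebraic_int[OF nonzero_idealD[OF gs]] algebraic_int_add by blast
      ultimately obtain b where b: "b \<in> A" "g + t \<in> b"
        by (auto simp: free_set_def multiples_def)
      obtain u where u: "u \<in> s" "t = g * u" using t gs_sub by blast
      obtain d c where dc: "nonzero_ideal d" "g \<in> d" "ideal c OK" "1 \<notin> c"
        "c <+>\<^bsub>OK\<^esub> s = carrier OK" "ideal_prod OK d c = b"
        using ideal_factor_coprime[OF nf A[rule_format, OF b(1)] s' gint gA[OF b(1)] u(1)] b(2) u(2) by metis
      have dX: "d \<in> X"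
        using dc(1,2) principal_subset nonzero_idealD by (auto simp: X_def)
      have "c <+>\<^bsub>OK\<^esub> f d = carrier OK"
        using coprime_mono[OF dc(3) s' nonzero_idealD[OF f(1)[OF dX]] s(2)[OF dX] dc(5)] .
      from f(2)[OF dX dc(3,4) this] dc(6) b(1) show False by simp
    qed
  qed
qed

text \<open>The shift $g$ is corrected for one $h$ after the other. Since $h + g \in d$ and $1 = x
  + y$ with $x \in c$, $y \in s$, adding $-(h + g) y \in s$ turns $h + g$ into $(h + g) x \in dc$
  without disturbing the positions already treated. The assumption $Q \subseteq d$ is what keeps
  $h + g$ in $d$ for all shifts $g \in Q$.\<close>

lemma simultaneous_multiples:
  fixes B :: "'k::field_char_0 set set"
  assumes nf: "number_field TYPE('k)" and B: "\<forall>b\<in>B. nonzero_ideal b"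
    and Q: "nonzero_ideal Q" and W: "finite W"
    and div: "\<And>h. h \<in> W \<Longrightarrow> \<exists>d\<in>B \<union> D_ideals B. h \<in> d \<and> Q \<subseteq> d"
  shows "\<exists>g\<in>Q. \<exists>s. nonzero_ideal s \<and> s \<subseteq> Q \<and> (\<forall>h\<in>W. \<forall>t\<in>s. h + g + t \<in> multiples B)"
  using W div
proof (induction W)
  case empty
  show ?case using Q ideal_zero[OF nonzero_idealD[OF Q]] by blast
next
  case (insert h W)
  note Q' = nonzero_idealD[OF Q]
  obtain g s where g: "g \<in> Q" and s: "nonzero_ideal s" "s \<subseteq> Q"
    and W: "\<And>h t. h \<in> W \<Longrightarrow> t \<in> s \<Longrightarrow> h + g + t \<in> multiples B"
    using insert.IH insert.prems by auto
  note s' = nonzero_idealD[OF s(1)]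
  obtain d where d: "d \<in> B \<union> D_ideals B" "h \<in> d" "Q \<subseteq> d" using insert.prems by blast
  have nzd: "nonzero_ideal d" using d(1) B nonzero_ideal_D_ideals by blast
  note d' = nonzero_idealD[OF nzd]
  have hg: "h + g \<in> d" using d g by (intro ideal_add[OF d']) auto
  have "\<exists>u\<in>s. \<exists>b\<in>B. h + g + u \<in> b"
  proof (cases "d \<in> B")
    case True
    with hg show ?thesis using ideal_zero[OF s'] by (intro bexI[of _ 0] bexI[of _ d]) auto
  next
    case False
    with d(1) have "d \<in> D_ideals B" by blast
    then obtain c where c: "ideal c OK" "c <+>\<^bsub>OK\<^esub> s = carrier OK" "ideal_prod OK d c \<in> B"
      using s(1) unfolding D_ideals_iff[OF nf B] by blast
    obtain x y where xy: "x \<in> c" "y \<in> s" "x + y = 1"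
      using c(2) unfolding set_add_eq_carrier_iff[OF c(1) s'] by blast
    have "- ((h + g) * y) \<in> s"
      using xy(2) ideal_algebraic_int[OF d' hg] by (intro ideal_minus ideal_lmult s')
    moreover have "h + g + - ((h + g) * y) = (h + g) * x"
      using xy(3) by (metis add_diff_cancel_right' diff_conv_add_uminus mult.right_neutral right_diff_distrib)
    moreover have "(h + g) * x \<in> ideal_prod OK d c" using hg xy(1) by (rule ideal_prod_OK_mult)
    ultimately show ?thesis using c(3) by metis
  qed
  then obtain u b where u: "u \<in> s" "b \<in> B" "h + g + u \<in> b" by blast
  note b' = nonzero_idealD[OF B[rule_format, OF u(2)]]
  let ?s = "ideal_prod OK s b"
  show ?case
  proof (intro bexI exI conjI ballI)
    show "nonzero_ideal ?s" by (rule nonzero_ideal_prod[OF s(1) B[rule_format, OF u(2)]])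
    show "?s \<subseteq> Q" using ideal_prod_subset_left[OF s' b'] s(2) by blast
    show "g + u \<in> Q" using u(1) s(2) g by (intro ideal_add[OF Q']) auto
    fix h' t assume h': "h' \<in> insert h W" and t: "t \<in> ?s"
    have ts: "t \<in> s" "t \<in> b"
      using t ideal_prod_subset_left[OF s' b'] ideal_prod_subset_right[OF s' b'] by blast+
    show "h' + (g + u) + t \<in> multiples B"
    proof (cases "h' \<in> W")
      case True
      from W[OF True ideal_add[OF s' u(1) ts(1)]] show ?thesis by (simp add: add.assoc)
    next
      case False
      with h' have "h' = h" by blast
      then have "h' + (g + u) + t \<in> b"
        using ideal_add[OF b' u(3) ts(2)] by (simp add: add.assoc)
      with u(2) show ?thesis by (auto simp: multiples_def)
    qed
  qed
qed

lemma eta_values: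
  "algebraic_int h \<Longrightarrow> eta A h = (if h \<in> multiples A then 0 else 1)"
  by (auto simp: eta_def free_set_def indicator_def)

text \<open>For each $h$ in the window let $q_h$ be an ideal of $B \cup D(B)$ containing $h$, or
  an ideal with $h + q_h$ free, according to the value of $\eta^*$ at $h$. Shifts inside the
  intersection of the $q_h$ preserve the ones, and among them are the shifts that create the
  zeros.\<close>

lemma eta_star_pattern_in_eta:
  fixes B :: "'k::field_char_0 set set"
  assumes nf: "number_field TYPE('k)" and B: "\<forall>b\<in>B. nonzero_ideal b"
    and W: "finite W" "W \<subseteq> carrier OK"
  obtains g s where "algebraic_int g" "nonzero_ideal s"
    "\<And>h t. h \<in> W \<Longrightarrow> t \<in> s \<Longrightarrow> eta B (h + g + t) = eta (star B) h"
proof -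
  let ?M = "multiples (star B)"
  have star: "\<forall>b\<in>star B. nonzero_ideal b"
    using B nonzero_ideal_D_ideals by (auto simp: star_def prim_def)
  have "\<exists>q. nonzero_ideal q \<and> (if h \<in> ?M then q \<in> B \<union> D_ideals B \<and> h \<in> q
      else \<forall>t\<in>q. h + t \<in> free_set (star B))" if h: "h \<in> W" for h
  proof (cases "h \<in> ?M")
    case True
    then obtain q where "q \<in> B \<union> D_ideals B" "h \<in> q"
      unfolding multiples_star[OF nf B] by blast
    then show ?thesis using True B nonzero_ideal_D_ideals by auto
  next
    case False
    with h W(2) have "h \<in> free_set (star B)" by (auto simp: free_set_def)
    from free_coset_if_no_D_ideals[OF nf star D_ideals_star[OF nf B] this] show ?thesis
      using False by metis
  qed
  then obtain q where q: "\<And>h. h \<in> W \<Longrightarrow> nonzero_ideal (q h)"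
    "\<And>h. h \<in> W \<Longrightarrow> h \<in> ?M \<Longrightarrow> q h \<in> B \<union> D_ideals B \<and> h \<in> q h"
    "\<And>h t. h \<in> W \<Longrightarrow> h \<notin> ?M \<Longrightarrow> t \<in> q h \<Longrightarrow> h + t \<in> free_set (star B)"
    by metis
  obtain Q where Q: "nonzero_ideal Q" "\<And>h. h \<in> W \<Longrightarrow> Q \<subseteq> q h"
    using finite_common_subideal[of "q ` W"] W(1) q(1) by (metis finite_imageI imageE imageI)
  note Q' = nonzero_idealD[OF Q(1)]
  have "\<exists>g\<in>Q. \<exists>s. nonzero_ideal s \<and> s \<subseteq> Q \<and> (\<forall>h\<in>W \<inter> ?M. \<forall>t\<in>s. h + g + t \<in> multiples B)"
  proof (rule simultaneous_multiples[OF nf B Q(1)])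
    fix h assume "h \<in> W \<inter> ?M"
    then show "\<exists>d\<in>B \<union> D_ideals B. h \<in> d \<and> Q \<subseteq> d" using q(2) Q(2) by blast
  qed (use W in auto)
  then obtain g s where g: "g \<in> Q" and s: "nonzero_ideal s" "s \<subseteq> Q"
    and mult: "\<And>h t. h \<in> W \<Longrightarrow> h \<in> ?M \<Longrightarrow> t \<in> s \<Longrightarrow> h + g + t \<in> multiples B"
    by blast
  show ?thesis
  proof (rule that[OF ideal_algebraic_int[OF Q' g] s(1)])
    fix h t assume h: "h \<in> W" and t: "t \<in> s"
    have hint: "algebraic_int h" using h W(2) by auto
    have gt: "g + t \<in> Q" using g t s(2) by (intro ideal_add[OF Q']) auto
    have sum_int: "algebraic_int (h + g + t)"
      using algebraic_int_add[OF hint ideal_algebraic_int[OF Q' gt]] by (simp add: add.assoc)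
    have iff: "h + g + t \<in> multiples B \<longleftrightarrow> h \<in> ?M"
    proof
      assume *: "h + g + t \<in> multiples B"
      show "h \<in> ?M"
      proof (rule ccontr)
        assume "h \<notin> ?M"
        with q(3)[OF h] gt Q(2)[OF h] have "h + (g + t) \<in> free_set (star B)" by blast
        then have "h + g + t \<notin> ?M" by (simp add: free_set_def add.assoc)
        with * show False unfolding multiples_star[OF nf B] by (auto simp: multiples_def)
      qed
    qed (rule mult[OF h _ t])
    show "eta B (h + g + t) = eta (star B) h"
      unfolding eta_values[OF sum_int] eta_values[OF hint] iff ..
  qed
qed

section \<open>Orbit closures\<close>

lemma topspace_config_space: "topspace config_space = carrier OK \<rightarrow>\<^sub>E {0, 1}"
  by (simp add: config_space_def)

lemma eta_in_config_space: "eta A \<in> topspace config_space"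
  unfolding topspace_config_space by (auto simp: eta_def indicator_def)

lemma shift_in_config_space:
  fixes x :: "'k::field_char_0 \<Rightarrow> nat"
  assumes "x \<in> topspace config_space" "algebraic_int g"
  shows "shift g x \<in> topspace config_space"
  unfolding topspace_config_space shift_def
proof (rule restrict_PiE_iff[THEN iffD2], intro ballI)
  fix h :: 'k assume "h \<in> carrier OK"
  then have "h + g \<in> carrier OK" using assms(2) by (simp add: algebraic_int_add)
  with assms(1) show "x (h + g) \<in> {0, 1}"
    unfolding topspace_config_space by (rule PiE_mem)
qed

lemma shift_apply: "algebraic_int h \<Longrightarrow> shift g x h = x (h + g)"
  by (simp add: shift_def)

text \<open>The basic open neighbourhoods of $y$ prescribe finitely many coordinates, so the
  closure consists of the points whose finite patterns all occur in $x$.\<close>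

lemma mem_orbit_closure_iff:
  fixes x y :: "'k::field_char_0 \<Rightarrow> nat"
  assumes x: "x \<in> topspace config_space"
  shows "y \<in> orbit_closure x \<longleftrightarrow> y \<in> topspace config_space \<and>
    (\<forall>W. finite W \<longrightarrow> W \<subseteq> carrier OK \<longrightarrow> (\<exists>g. algebraic_int g \<and> (\<forall>h\<in>W. y h = x (h + g))))"
    (is "?L \<longleftrightarrow> ?R")
proof
  assume L: ?L
  then have y: "y \<in> topspace config_space" by (simp add: orbit_closure_def in_closure_of)
  moreover have "\<exists>g. algebraic_int g \<and> (\<forall>h\<in>W. y h = x (h + g))"
    if W: "finite W" "W \<subseteq> carrier OK" for W
  proof -
    define U where "U = PiE (carrier OK) (\<lambda>h. if h \<in> W then {y h} else {0, 1})"
    have yv: "y h \<in> {0, 1}" if "h \<in> carrier OK" for h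
      using y that unfolding topspace_config_space by blast
    have "openin config_space U"
      unfolding config_space_def U_def
    proof (rule product_topology_basis)
      show "openin (discrete_topology {0, 1}) (if h \<in> W then {y h} else {0, 1})" for h
        using yv[of h] W(2) by (cases "h \<in> W") auto
      have "{i. (if i \<in> W then {y i} else {0, 1}) \<noteq> topspace (discrete_topology {0, 1::nat})} \<subseteq> W"
        by auto
      then show "finite {i. (if i \<in> W then {y i} else {0, 1}) \<noteq> topspace (discrete_topology {0, 1})}"
        using W(1) finite_subset by blast
    qed
    moreover have "y \<in> U" using y unfolding topspace_config_space U_def by (auto simp: PiE_iff)
    ultimately obtain g where g: "algebraic_int g" "shift g x \<in> U"
      using L unfolding orbit_closure_def in_closure_of by auto
    have "y h = x (h + g)" if h: "h \<in> W" for h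
    proof -
      have "shift g x h = y h" using g(2) h W(2) unfolding U_def by (auto simp: PiE_iff split: if_splits)
      then show ?thesis using h W(2) by (auto simp: shift_apply)
    qed
    with g(1) show ?thesis by blast
  qed
  ultimately show ?R by blast
next
  assume R: ?R
  show ?L
    unfolding orbit_closure_def in_closure_of
  proof (intro conjI allI impI)
    show y: "y \<in> topspace config_space" using R by blast
    fix T assume T: "y \<in> T \<and> openin config_space T"
    then obtain U where U: "finite {i \<in> carrier OK. U i \<noteq> topspace (discrete_topology {0, 1::nat})}"
      "y \<in> PiE (carrier OK) U" "PiE (carrier OK) U \<subseteq> T"
      unfolding config_space_def openin_product_topology_alt by blast
    define W where "W = {i \<in> carrier OK. U i \<noteq> topspace (discrete_topology {0, 1::nat})}"
    obtain g where g: "algebraic_int g" "\<forall>h\<in>W. y h = x (h + g)"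
      using R U(1) unfolding W_def[symmetric] by (metis (no_types, lifting) W_def mem_Collect_eq subsetI)
    have "shift g x \<in> PiE (carrier OK) U"
    proof (rule PiE_I)
      fix h :: 'k assume h: "h \<in> carrier OK"
      show "shift g x h \<in> U h"
      proof (cases "h \<in> W")
        case True
        then have "shift g x h = y h" using g(2) h by (simp add: shift_apply)
        then show ?thesis using U(2) h by auto
      next
        case False
        then have "U h = {0, 1}" using h by (auto simp: W_def)
        moreover have "shift g x h \<in> {0, 1}"
          using shift_in_config_space[OF x, of g] g(1) h unfolding topspace_config_space by auto
        ultimately show ?thesis by simp
      qed
    qed (simp add: shift_def)
    with U(3) g(1) show "\<exists>z. z \<in> {shift g x |g. g \<in> carrier OK} \<and> z \<in> T" by auto
  qed
qed

lemma orbit_closure_subset_config_space: "orbit_closure x \<subseteq> topspace config_space"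
  unfolding orbit_closure_def by (rule closure_of_subset_topspace)

lemma shift_mem_orbit_closure:
  fixes x y :: "'k::field_char_0 \<Rightarrow> nat"
  assumes x: "x \<in> topspace config_space" and y: "y \<in> orbit_closure x" and g: "algebraic_int g"
  shows "shift g y \<in> orbit_closure x"
  unfolding mem_orbit_closure_iff[OF x]
proof (intro conjI allI impI)
  show "shift g y \<in> topspace config_space"
    using y g orbit_closure_subset_config_space by (intro shift_in_config_space) auto
  fix W :: "'k set" assume W: "finite W" "W \<subseteq> carrier OK"
  have "finite ((\<lambda>h. h + g) ` W)" "(\<lambda>h. h + g) ` W \<subseteq> carrier OK"
    using W g by (auto simp: subset_eq intro: algebraic_int_add)
  then obtain k where k: "algebraic_int k" "\<forall>h\<in>(\<lambda>h. h + g) ` W. y h = x (h + k)"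
    using y unfolding mem_orbit_closure_iff[OF x] by blast
  show "\<exists>k. algebraic_int k \<and> (\<forall>h\<in>W. shift g y h = x (h + k))"
  proof (intro exI conjI ballI)
    show "algebraic_int (g + k)" using g k(1) by (rule algebraic_int_add)
    fix h assume h: "h \<in> W"
    then have "shift g y h = y (h + g)" using W(2) by (auto simp: shift_apply)
    also have "\<dots> = x (h + (g + k))" using k(2) h by (simp add: add.assoc)
    finally show "shift g y h = x (h + (g + k))" .
  qed
qed

lemma orbit_closure_least:
  assumes "closedin config_space M" "\<forall>g\<in>carrier OK. shift g ` M \<subseteq> M" "x \<in> M"
  shows "orbit_closure x \<subseteq> M"
  unfolding orbit_closure_def using assms by (intro closure_of_minimal) blast+

lemma closedin_orbit_closure: "closedin config_space (orbit_closure x)"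
  unfolding orbit_closure_def by (rule closedin_closure_of)

lemma orbit_closure_mono:
  assumes "x \<in> topspace config_space" "y \<in> orbit_closure x"
  shows "orbit_closure y \<subseteq> orbit_closure x"
  using assms shift_mem_orbit_closure
  by (intro orbit_closure_least closedin_orbit_closure) auto

lemma self_mem_orbit_closure: "x \<in> topspace config_space \<Longrightarrow> x \<in> orbit_closure x"
  by (auto simp: mem_orbit_closure_iff intro!: exI[of _ 0])

text \<open>A pattern of $\eta^*$ occurs in $\eta$ at all positions of a coset $g + s$. On a large
  enough window, $y$ agrees with a shift of $\eta$ by some unknown $k$; if the window contains $W
  + f$ for representatives $f$ of all classes modulo $s$, then some $k + f$ is in $g + s$ and $y$
  shows the pattern at position $f$.\<close>

lemma eta_star_in_orbit_closure:
  fixes B :: "'k::field_char_0 set set"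
  assumes nf: "number_field TYPE('k)" and B: "\<forall>b\<in>B. nonzero_ideal b"
    and y: "y \<in> orbit_closure (eta B)"
  shows "eta (star B) \<in> orbit_closure y"
proof -
  have yt: "y \<in> topspace config_space" using y orbit_closure_subset_config_space by blast
  show ?thesis
    unfolding mem_orbit_closure_iff[OF yt]
  proof (intro conjI allI impI)
    fix W :: "'k set" assume W: "finite W" "W \<subseteq> carrier OK"
    from eta_star_pattern_in_eta[OF nf B W]
    obtain g s where g: "algebraic_int g" and s: "nonzero_ideal s"
      and pat: "\<And>h t. h \<in> W \<Longrightarrow> t \<in> s \<Longrightarrow> eta B (h + g + t) = eta (star B) h" by metis
    obtain F where F: "finite F" "F \<subseteq> carrier OK" "\<And>x. algebraic_int x \<Longrightarrow> \<exists>f\<in>F. x - f \<in> s"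
      using finite_index_nonzero_ideal[OF nf s] unfolding finite_index_def by auto
    define V where "V = (\<lambda>(h, f). h + f) ` (W \<times> F)"
    have "finite V" "V \<subseteq> carrier OK"
      using W F(1,2) by (auto simp: V_def subset_eq intro: algebraic_int_add)
    then obtain k where k: "algebraic_int k" "\<forall>v\<in>V. y v = eta B (v + k)"
      using y unfolding mem_orbit_closure_iff[OF eta_in_config_space] by blast
    obtain f where f: "f \<in> F" "g - k - f \<in> s"
      using F(3)[OF algebraic_int_diff[OF g k(1)]] by blast
    have "eta (star B) h = y (h + f)" if h: "h \<in> W" for h
    proof -
      have "- (g - k - f) \<in> s" by (rule ideal_minus[OF nonzero_idealD[OF s] f(2)])
      from pat[OF h this] have "eta (star B) h = eta B (h + f + k)" by (simp add: algebra_simps)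
      also have "\<dots> = y (h + f)" using k(2) h f(1) by (auto simp: V_def)
      finally show ?thesis .
    qed
    moreover have "algebraic_int f" using f(1) F(2) by auto
    ultimately show "\<exists>f. algebraic_int f \<and> (\<forall>h\<in>W. eta (star B) h = y (h + f))" by blast
  qed (rule eta_in_config_space)
qed

lemma finite_a_rcosets:
  fixes S :: "'k::field_char_0 set"
  assumes fi: "finite_index S" and S: "additive_subgroup S OK"
  shows "finite (a_rcosets\<^bsub>OK\<^esub> S)"
proof -
  interpret additive_subgroup S OK by (rule S)
  obtain F where F: "finite F" "F \<subseteq> carrier OK" "\<And>x. algebraic_int x \<Longrightarrow> \<exists>f\<in>F. x - f \<in> S"
    using fi unfolding finite_index_def by auto
  have "a_rcosets\<^bsub>OK\<^esub> S \<subseteq> (\<lambda>f. S +>\<^bsub>OK\<^esub> f) ` F"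
  proof
    fix X assume "X \<in> a_rcosets\<^bsub>OK\<^esub> S"
    then obtain x where x: "algebraic_int x" "X = S +>\<^bsub>OK\<^esub> x"
      unfolding A_RCOSETS_def' by auto
    obtain f where f: "f \<in> F" "x - f \<in> S" using F(3)[OF x(1)] by blast
    have "S +>\<^bsub>OK\<^esub> x = S +>\<^bsub>OK\<^esub> f"
    proof (rule equalityI; rule subsetI)
      fix z assume "z \<in> S +>\<^bsub>OK\<^esub> x"
      then obtain a where a: "a \<in> S" "z = a + x" unfolding a_r_coset_def' by auto
      moreover have "a + (x - f) \<in> S" using a_closed[OF a(1) f(2)] by simp
      ultimately show "z \<in> S +>\<^bsub>OK\<^esub> f"
        unfolding a_r_coset_def' by (intro UN_I[of "a + (x - f)"]) simp_all
    next
      fix z assume "z \<in> S +>\<^bsub>OK\<^esub> f"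
      then obtain a where a: "a \<in> S" "z = a + f" unfolding a_r_coset_def' by auto
      moreover have "a + - (x - f) \<in> S"
        using S a(1) f(2) unfolding additive_subgroup_OK_iff by blast
      ultimately show "z \<in> S +>\<^bsub>OK\<^esub> x"
        unfolding a_r_coset_def' by (intro UN_I[of "a + - (x - f)"]) simp_all
    qed
    with x(2) f(1) show "X \<in> (\<lambda>f. S +>\<^bsub>OK\<^esub> f) ` F" by blast
  qed
  with F(1) show ?thesis by (meson finite_imageI finite_subset)
qed

text \<open>The period subgroup at $g$ is an ideal of $A$ containing $g$ if $g$ is a multiple, and
  otherwise an ideal of shifts that keep $g$ free.\<close>

lemma toeplitz_eta_if_no_D_ideals:
  fixes A :: "'k::field_char_0 set set"
  assumes nf: "number_field TYPE('k)" and A: "\<forall>b\<in>A. nonzero_ideal b"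
    and D: "D_ideals A = {}"
  shows "toeplitz_array (eta A)"
  unfolding toeplitz_array_def
proof (intro conjI ballI)
  fix g :: 'k assume "g \<in> carrier OK"
  then have g: "algebraic_int g" by simp
  obtain s v where s: "nonzero_ideal s" and const: "\<And>t. t \<in> s \<Longrightarrow> eta A (g + t) = v"
  proof (cases "g \<in> multiples A")
    case True
    then obtain b where b: "b \<in> A" "g \<in> b" by (auto simp: multiples_def)
    note b' = nonzero_idealD[OF A[rule_format, OF b(1)]]
    have "eta A (g + t) = 0" if t: "t \<in> b" for t
      using ideal_add[OF b' b(2) t] b(1) ideal_algebraic_int[OF b' ideal_add[OF b' b(2) t]]
      by (auto simp: eta_values multiples_def)
    then show ?thesis using that A[rule_format, OF b(1)] by blast
  next
    case False
    with g have "g \<in> free_set A" by (simp add: free_set_def)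
    from free_coset_if_no_D_ideals[OF nf A D this]
    obtain s where s: "nonzero_ideal s" "\<And>t. t \<in> s \<Longrightarrow> g + t \<in> free_set A" by metis
    have "eta A (g + t) = 1" if "t \<in> s" for t
      using s(2)[OF that] by (auto simp: eta_values free_set_def)
    then show ?thesis using that s(1) by blast
  qed
  have sub: "additive_subgroup s OK" using nonzero_idealD[OF s] by (simp add: ideal_def)
  have "finite (a_rcosets\<^bsub>OK\<^esub> s)"
    by (rule finite_a_rcosets[OF finite_index_nonzero_ideal[OF nf s] sub])
  moreover have "eta A constant_on (\<lambda>h. g + h) ` s"
    unfolding constant_on_def using const by blast
  ultimately show "\<exists>\<Gamma>. additive_subgroup \<Gamma> OK \<and> finite (a_rcosets\<^bsub>OK\<^esub> \<Gamma>) \<and>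
      eta A constant_on (\<lambda>h. g + h) ` \<Gamma>" using sub by blast
qed (rule eta_in_config_space)

theorem theorem1:
  fixes B :: "'k::field_char_0 set set"
  assumes "number_field TYPE('k)"
    and "primitive_collection B"
  shows "toeplitz_array (eta (star B)) \<and>
         orbit_closure (eta (star B)) \<subseteq> orbit_closure (eta B) \<and>
         minimal_subset (orbit_closure (eta (star B))) (orbit_closure (eta B)) \<and>
         (\<forall>M. minimal_subset M (orbit_closure (eta B)) \<longrightarrow> M = orbit_closure (eta (star B))) \<and>
         (\<forall>h\<in>carrier OK. eta (star B) h \<le> eta B h)"
proof -
  note nf = assms(1)
  have B: "\<forall>b\<in>B. nonzero_ideal b"
    using assms(2) by (auto simp: primitive_collection_def)
  have star: "\<forall>b\<in>star B. nonzero_ideal b"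
    using B nonzero_ideal_D_ideals by (auto simp: star_def prim_def)
  let ?X = "orbit_closure (eta B)" and ?Y = "orbit_closure (eta (star B))"
  have le: "eta (star B) h \<le> eta B h" if "h \<in> carrier OK" for h
  proof -
    have "multiples B \<subseteq> multiples (star B)"
      unfolding multiples_star[OF nf B] by (auto simp: multiples_def)
    with that show ?thesis by (auto simp: eta_values)
  qed
  have in_cl: "eta (star B) \<in> orbit_closure y" if "y \<in> ?X" for y
    using eta_star_in_orbit_closure[OF nf B that] .
  have sub_all: "?Y \<subseteq> orbit_closure y" if y: "y \<in> ?X" for y
    using y in_cl[OF y] orbit_closure_subset_config_space by (intro orbit_closure_mono) auto
  have YX: "?Y \<subseteq> ?X" by (rule sub_all[OF self_mem_orbit_closure[OF eta_in_config_space]])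
  have "toeplitz_array (eta (star B))"
    by (rule toeplitz_eta_if_no_D_ideals[OF nf star D_ideals_star[OF nf B]])
  moreover have "minimal_subset ?Y ?X"
    unfolding minimal_subset_def
  proof (intro conjI ballI)
    show "?Y \<noteq> {}" using self_mem_orbit_closure[OF eta_in_config_space] by blast
    show "shift g ` ?Y \<subseteq> ?Y" if "g \<in> carrier OK" for g
      using that shift_mem_orbit_closure[OF eta_in_config_space] by auto
    show "?Y \<subseteq> orbit_closure y" if "y \<in> ?Y" for y using that YX sub_all by blast
  qed (rule YX closedin_orbit_closure)+
  moreover have "M = ?Y" if M: "minimal_subset M ?X" for M
  proof -
    obtain y where y: "y \<in> M" "y \<in> ?X" using M unfolding minimal_subset_def by blast
    have "orbit_closure y \<subseteq> M"
      using M y(1) unfolding minimal_subset_def by (intro orbit_closure_least) auto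
    with in_cl[OF y(2)] have "eta (star B) \<in> M" by blast
    then show ?thesis
      using M orbit_closure_least[of M "eta (star B)"] unfolding minimal_subset_def by blast
  qed
  ultimately show ?thesis using YX le by blast
qed

end
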